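(* For positive integers $d,n$ let $M_d(n)$ denote the smallest positive integer $N$ such that every $d$-dimensional array of size $N\times\cdots\times N$ contains a monotone $d$-dimensional subarray of size $n\times\cdots\times n$. Then: (i) $M_2(n)\le 2^{2^{(2+o(1))n}}$; (ii) $M_3(n)\le 2^{2^{(2+o(1))n^2}}$; (iii) for every $d\ge 4$, $M_d(n)\le 2^{2^{2^{O_d(n^{d-1})}}}$.
   Context: A $d$-dimensional array is an injective function $f\colon A_1\times\cdots\times A_d\to\mathbb{R}$, where $A_1,\dots,A_d$ are non-empty (finite) subsets of $\mathbb{Z}$; its size is $|A_1|\times\cdots\times|A_d|$. A subarray of $f$ is a restriction of $f$ to $B_1\times\cdots\times B_d$ with non-empty $B_i\subseteq A_i$. A $d$-dimensional array $f\colon A_1\times\cdots\times A_d\to\mathbb{R}$ is monotone if for each $i\in\{1,\dots,d\}$ one of the following holds: either $x\mapsto f(a_1,\dots,a_{i-1},x,a_{i+1},\dots,a_d)$ is increasing on $A_i$ for all choices of $a_j\in A_j$ ($j\ne i$), or it is decreasing on $A_i$ for all choices of $a_j\in A_j$ ($j\neq i$). Asymptotics: $d$ is fixed and $n\to\infty$. The $o(1)$ denotes a quantity depending only on $n$ that tends to $0$ as $n\to\infty$. $O_d(n^{d-1})$ denotes a quantity bounded by $C\,n^{d-1}$ for all positive integers $n$, for some constant $C=C(d)$ depending only on $d$. *)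

theory Defs
  imports Complex_Main "HOL-Library.FuncSet"
begin

text \<open>
  An array on \<open>A\<^sub>1 \<times> \<dots> \<times> A\<^sub>d\<close> is given by the dimension \<open>d\<close>, the sides \<open>A i\<close> for
  \<open>i \<in> {1..d}\<close>, and a function \<open>f\<close> on coordinate functions; only the values of \<open>f\<close> on
  \<open>grid d A\<close> are relevant.
\<close>

definition grid :: "nat \<Rightarrow> (nat \<Rightarrow> int set) \<Rightarrow> (nat \<Rightarrow> int) set" where
  "grid d A = Pi\<^sub>E {1..d} A"

definition is_array :: "nat \<Rightarrow> (nat \<Rightarrow> int set) \<Rightarrow> ((nat \<Rightarrow> int) \<Rightarrow> real) \<Rightarrow> bool" where
  "is_array d A f \<longleftrightarrow>
     (\<forall>i\<in>{1..d}. finite (A i) \<and> A i \<noteq> {}) \<and> inj_on f (grid d A)"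

definition has_cubic_size :: "nat \<Rightarrow> (nat \<Rightarrow> int set) \<Rightarrow> nat \<Rightarrow> bool" where
  "has_cubic_size d A n \<longleftrightarrow> (\<forall>i\<in>{1..d}. card (A i) = n)"

definition is_subarray ::
  "nat \<Rightarrow> (nat \<Rightarrow> int set) \<Rightarrow> ((nat \<Rightarrow> int) \<Rightarrow> real) \<Rightarrow>
   (nat \<Rightarrow> int set) \<Rightarrow> ((nat \<Rightarrow> int) \<Rightarrow> real) \<Rightarrow> bool" where
  "is_subarray d B g A f \<longleftrightarrow>
     (\<forall>i\<in>{1..d}. B i \<noteq> {} \<and> B i \<subseteq> A i) \<and> g = restrict f (grid d B)"

text \<open>
  The point \<open>a\<close> below ranges over the whole grid, but its \<open>i\<close>-th coordinate is overwritten; as the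
  sides of an array are non-empty, this amounts to all choices of the other coordinates.
  Since arrays are injective, strict and weak monotonicity agree on them.
\<close>

definition monotone_array :: "nat \<Rightarrow> (nat \<Rightarrow> int set) \<Rightarrow> ((nat \<Rightarrow> int) \<Rightarrow> real) \<Rightarrow> bool" where
  "monotone_array d A f \<longleftrightarrow>
     (\<forall>i\<in>{1..d}.
        (\<forall>a\<in>grid d A. strict_mono_on (A i) (\<lambda>x. f (a(i := x)))) \<or>
        (\<forall>a\<in>grid d A. strict_antimono_on (A i) (\<lambda>x. f (a(i := x)))))"

definition forces_monotone :: "nat \<Rightarrow> nat \<Rightarrow> nat \<Rightarrow> bool" where
  "forces_monotone d n N \<longleftrightarrow>
     (\<forall>A f. is_array d A f \<and> has_cubic_size d A N \<longrightarrow>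
        (\<exists>B g. is_subarray d B g A f \<and> has_cubic_size d B n \<and> monotone_array d B g))"

text \<open>
  \<open>LEAST\<close> is meaningful only if such an \<open>N\<close> exists, so a bound on \<open>M d n\<close> should be
  accompanied by an existence claim.
\<close>

definition M :: "nat \<Rightarrow> nat \<Rightarrow> nat" where
  "M d n = (LEAST N. N > 0 \<and> forces_monotone d n N)"

end

theory Submission
  imports Defs "HOL-Real_Asymp.Real_Asymp"
begin

text \<open>
  Cut an array into slices along its last coordinate. Suppose every slice contains a good subgrid.
  By the pigeonhole principle many slices share the same one, \<open>B\<close>. A pair \<open>x < y\<close> of
  these slices compares the two copies of \<open>B\<close> entrywise, and this 2-colouring of \<open>B\<close>
  contains one of \<open>q\<close> patterns. To be increasing (or decreasing) on a fixed pattern is a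
  transitive relation, so by the Erdos-Szekeres argument \<open>n ^ q\<close> slices contain \<open>n\<close> slices
  that are pairwise comparable with the same pattern.

  For \<open>d = 2\<close> take monotone sets \<open>B\<close> of size \<open>2 n\<close> and as patterns the \<open>n\<close>-subsets, at most
  \<open>2 ^ (2 n)\<close> up to sign. For \<open>d = 3\<close> take monotone \<open>2 n \<times> b\<close> rectangles, where \<open>b\<close> is about
  \<open>2 ^ (2 n)\<close>, large enough for every 2-colouring to have a monochromatic \<open>n \<times> n\<close> subrectangle;
  there are \<open>2 ^ ((2 + o(1)) n\<^sup>2)\<close> of these.

  For larger \<open>d\<close> this choice would lead to a tower. Instead the direction is allowed to depend on the
  line: the patterns are all sign functions on \<open>B\<close>, and one obtains an \<open>s \<times> \<dots> \<times> s\<close>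
  subarray with monotone lines at doubly exponential cost in \<open>s ^ d\<close>. Colouring each point by the
  directions of the lines through it, a Kovari-Sos-Turan argument with \<open>s = 2 ^ O(n ^ (d - 1))\<close>
  then makes all directions agree.
\<close>

section \<open>Pigeonhole and chains\<close>

text \<open>Label each \<open>x\<close> by the lengths of the longest \<open>R p\<close>-chains ending in \<open>x\<close>, for all \<open>p\<close>.\<close>

lemma chain_in_transitive_cover:
  fixes X :: "'a::linorder set" and R :: "'p \<Rightarrow> 'a \<Rightarrow> 'a \<Rightarrow> bool"
  assumes X: "finite X" and P: "finite P" "P \<noteq> {}" and n: "n \<ge> 1"
    and cover: "\<And>x y. x \<in> X \<Longrightarrow> y \<in> X \<Longrightarrow> x < y \<Longrightarrow> \<exists>p\<in>P. R p x y"
    and trans: "\<And>p x y z. p \<in> P \<Longrightarrow> R p x y \<Longrightarrow> R p y z \<Longrightarrow> R p x z"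
    and card: "n ^ card P \<le> card X"
  shows "\<exists>p\<in>P. \<exists>Y\<subseteq>X. card Y = n \<and> (\<forall>x\<in>Y. \<forall>y\<in>Y. x < y \<longrightarrow> R p x y)"
proof (rule ccontr)
  assume no: "\<not> ?thesis"
  define chain where "chain p C \<longleftrightarrow> C \<subseteq> X \<and> (\<forall>x\<in>C. \<forall>y\<in>C. x < y \<longrightarrow> R p x y)" for p C
  have short: "card C < n" if "p \<in> P" "chain p C" for p C
  proof (rule ccontr)
    assume "\<not> card C < n"
    then obtain Y where Y: "Y \<subseteq> C" "card Y = n"
      by (meson not_less obtain_subset_with_card_n)
    have "Y \<subseteq> X" "\<forall>x\<in>Y. \<forall>y\<in>Y. x < y \<longrightarrow> R p x y"
      using Y(1) \<open>chain p C\<close> unfolding chain_def by blast+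
    then show False using no \<open>p \<in> P\<close> Y(2) by blast
  qed
  define Cs where "Cs p x = {C. chain p C \<and> x \<in> C \<and> (\<forall>y\<in>C. y \<le> x)}" for p x
  define l where "l p x = Max (card ` Cs p x)" for p x
  have fin: "finite (Cs p x)" for p x
    by (rule finite_subset[of _ "Pow X"]) (use X in \<open>auto simp: Cs_def chain_def\<close>)
  have ex: "\<exists>C\<in>Cs p x. card C = l p x" if "x \<in> X" for p x
  proof -
    have "{x} \<in> Cs p x" using that by (auto simp: Cs_def chain_def)
    then have "l p x \<in> card ` Cs p x" unfolding l_def using fin by (intro Max_in) auto
    then show ?thesis by auto
  qed
  have ub: "card C \<le> l p x" if "C \<in> Cs p x" for C p x
    unfolding l_def using that fin by simp
  have less: "l p x < l p y" if "x \<in> X" "y \<in> X" "x < y" "R p x y" "p \<in> P" for p x y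
  proof -
    obtain C where C: "C \<in> Cs p x" "card C = l p x" using ex \<open>x \<in> X\<close> by blast
    have "R p z y" if "z \<in> C" for z
      using that C(1) \<open>R p x y\<close> trans[OF \<open>p \<in> P\<close>, of z x y]
      by (cases "z = x") (auto simp: Cs_def chain_def)
    moreover have "z < y" if "z \<in> C" for z
      using that C(1) \<open>x < y\<close> by (auto simp: Cs_def)
    ultimately have "insert y C \<in> Cs p y"
      using C(1) \<open>y \<in> X\<close> by (fastforce simp: Cs_def chain_def)
    moreover have "y \<notin> C" "finite C"
      using C(1) \<open>x < y\<close> X by (auto simp: Cs_def chain_def intro: finite_subset)
    ultimately show ?thesis using ub[of "insert y C" p y] C(2) by simp
  qed
  define g where "g x = (\<lambda>p\<in>P. l p x)" for x
  have "inj_on g X"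
  proof (rule linorder_inj_onI')
    fix x y assume xy: "x \<in> X" "y \<in> X" "x < y"
    then obtain p where "p \<in> P" "R p x y" using cover by blast
    then have "g x p < g y p" using less xy by (simp add: g_def)
    then show "g x \<noteq> g y" by auto
  qed
  moreover have "g ` X \<subseteq> PiE P (\<lambda>_. {..<n} - {0})"
  proof (intro image_subsetI PiE_I)
    fix x p assume "x \<in> X" "p \<in> P"
    then obtain C where C: "C \<in> Cs p x" "card C = l p x" using ex by blast
    then have "finite C" "x \<in> C"
      using X by (auto simp: Cs_def chain_def intro: finite_subset)
    then have "card C \<noteq> 0" by auto
    then show "g x p \<in> {..<n} - {0}"
      using C short[OF \<open>p \<in> P\<close>, of C] \<open>p \<in> P\<close> by (auto simp: g_def Cs_def)
  qed (simp add: g_def)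
  ultimately have "card X \<le> card (PiE P (\<lambda>_. {..<n} - {0}))"
    using P by (intro card_inj_on_le[of g]) (auto intro: finite_PiE)
  also have "\<dots> = (n - 1) ^ card P" using P n by (simp add: card_PiE)
  also have "\<dots> < n ^ card P" using P n by (intro power_strict_mono) (auto simp: card_gt_0_iff)
  finally show False using card by simp
qed

text \<open>The common engine of every bound below. Each slice \<open>x\<close> chooses a good
  \<open>B\<close>. There are at most \<open>Q\<close> choices, so some fibre has at least
  \<open>n ^ q\<close> elements, and the chain lemma applies inside it with the patterns of that
  \<open>B\<close>. A single trivial pattern turns it into the plain pigeonhole principle.\<close>

lemma pigeonhole_chain:
  fixes X :: "'a::linorder set" and R :: "'b \<Rightarrow> 'p \<Rightarrow> 'a \<Rightarrow> 'a \<Rightarrow> bool"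
  assumes X: "finite X" and F: "finite F" "card F \<le> Q" and Q: "Q \<ge> 1" and n: "n \<ge> 1"
    and good: "\<And>x. x \<in> X \<Longrightarrow> \<exists>B\<in>F. good x B"
    and P: "\<And>B. B \<in> F \<Longrightarrow> finite (P B) \<and> P B \<noteq> {} \<and> card (P B) \<le> q"
    and cover: "\<And>B x y. B \<in> F \<Longrightarrow> x \<in> X \<Longrightarrow> y \<in> X \<Longrightarrow> x < y \<Longrightarrow> \<exists>p\<in>P B. R B p x y"
    and trans: "\<And>B p x y z. B \<in> F \<Longrightarrow> p \<in> P B \<Longrightarrow> R B p x y \<Longrightarrow> R B p y z \<Longrightarrow> R B p x z"
    and card: "Q * n ^ q \<le> card X"
  shows "\<exists>B\<in>F. \<exists>p\<in>P B. \<exists>Y\<subseteq>X. card Y = n \<and> (\<forall>x\<in>Y. good x B) \<and>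
    (\<forall>x\<in>Y. \<forall>y\<in>Y. x < y \<longrightarrow> R B p x y)"
proof -
  from good obtain h where h: "\<And>x. x \<in> X \<Longrightarrow> h x \<in> F \<and> good x (h x)" by metis
  define fibre where "fibre B = {x\<in>X. h x = B}" for B
  have "\<exists>B\<in>F. n ^ q \<le> card (fibre B)"
  proof (rule ccontr)
    assume "\<not> ?thesis"
    then have small: "card (fibre B) < n ^ q" if "B \<in> F" for B using that by auto
    \<comment> \<open>The strict comparison of sums below requires \<open>F\<close> to be non-empty;
      this comes from the positive lower bound on \<open>card X\<close>.\<close>
    have "0 < Q * n ^ q" using Q n by simp
    then have "X \<noteq> {}" using card by auto
    then have "F \<noteq> {}" using good by blast
    have "X = (\<Union>B\<in>F. fibre B)" using h by (auto simp: fibre_def)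
    then have "card X \<le> (\<Sum>B\<in>F. card (fibre B))" using card_UN_le[OF F(1)] by metis
    also have "\<dots> < (\<Sum>B\<in>F. n ^ q)" using F \<open>F \<noteq> {}\<close> small by (intro sum_strict_mono) auto
    also have "\<dots> \<le> Q * n ^ q" using F by simp
    finally show False using card by simp
  qed
  then obtain B where B: "B \<in> F" "n ^ q \<le> card (fibre B)" by blast
  \<comment> \<open>Different \<open>B\<close> may have different numbers of patterns;
    \<open>q\<close> bounds them uniformly.\<close>
  have "n ^ card (P B) \<le> n ^ q" using P[OF B(1)] n by (intro power_increasing) auto
  then have le: "n ^ card (P B) \<le> card (fibre B)" using B(2) by linarith
  have sub: "fibre B \<subseteq> X" by (auto simp: fibre_def)
  have "\<exists>p\<in>P B. \<exists>Y\<subseteq>fibre B. card Y = n \<and> (\<forall>x\<in>Y. \<forall>y\<in>Y. x < y \<longrightarrow> R B p x y)"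
  proof (rule chain_in_transitive_cover)
    show "\<exists>p\<in>P B. R B p x y" if "x \<in> fibre B" "y \<in> fibre B" "x < y" for x y
      using cover[OF B(1)] that sub by blast
    show "R B p x z" if "p \<in> P B" "R B p x y" "R B p y z" for p x y z
      using trans[OF B(1)] that by blast
  qed (use P[OF B(1)] n le finite_subset[OF sub X] in blast)+
  then obtain p Y where pY: "p \<in> P B" "Y \<subseteq> fibre B" "card Y = n"
    "\<forall>x\<in>Y. \<forall>y\<in>Y. x < y \<longrightarrow> R B p x y" by blast
  have "good x B" if "x \<in> fibre B" for x
    using h[of x] that by (simp add: fibre_def)
  then have "Y \<subseteq> X" "\<forall>x\<in>Y. good x B" using pY(2) sub by blast+
  then show ?thesis using B(1) pY(1,3,4) by blast
qed

section \<open>Directions of comparison, Erdos-Szekeres, and elementary counting\<close>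

definition less_dir :: "bool \<Rightarrow> real \<Rightarrow> real \<Rightarrow> bool" where
  "less_dir u x y \<longleftrightarrow> (if u then x < y else y < x)"

lemma less_dir_trans: "less_dir u x y \<Longrightarrow> less_dir u y z \<Longrightarrow> less_dir u x z"
  by (auto simp: less_dir_def split: if_splits)

lemma ex_less_dir: "x \<noteq> y \<Longrightarrow> \<exists>u. less_dir u x y"
  unfolding less_dir_def by (metis linorder_neq_iff)

text \<open>The patterns are the two directions, so the chain lemma needs
  \<open>n ^ card UNIV = n ^ 2\<close> points; injectivity makes every pair comparable in one of
  them.\<close>

lemma erdos_szekeres:
  fixes f :: "int \<Rightarrow> real"
  assumes "finite X" "inj_on f X" "n \<ge> 1" "n\<^sup>2 \<le> card X"
  shows "\<exists>Y\<subseteq>X. card Y = n \<and> (\<exists>u. \<forall>x\<in>Y. \<forall>y\<in>Y. x < y \<longrightarrow> less_dir u (f x) (f y))"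
proof -
  have "\<exists>u\<in>UNIV. less_dir u (f x) (f y)" if "x \<in> X" "y \<in> X" "x < y" for x y
    using that assms(2) ex_less_dir[of "f x" "f y"] by (auto dest: inj_onD)
  then have "\<exists>u\<in>UNIV. \<exists>Y\<subseteq>X. card Y = n \<and> (\<forall>x\<in>Y. \<forall>y\<in>Y. x < y \<longrightarrow> less_dir u (f x) (f y))"
    using assms by (intro chain_in_transitive_cover)
      (auto simp: power2_eq_square intro: less_dir_trans)
  then show ?thesis by blast
qed

lemma card_sized_subsets_le:
  assumes "finite A" shows "card {S. S \<subseteq> A \<and> card S = k} \<le> 2 ^ card A"
  using assms card_mono[of "Pow A" "{S. S \<subseteq> A \<and> card S = k}"] by (auto simp: card_Pow)

lemma bool_pigeonhole:
  fixes c :: "'a \<Rightarrow> bool"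
  assumes "2 * n \<le> card S"
  shows "\<exists>T\<subseteq>S. card T = n \<and> (\<exists>u. \<forall>x\<in>T. c x = u)"
proof -
  have "{x\<in>S. c x} \<union> {x\<in>S. \<not> c x} = S" by blast
  then have "card S \<le> card {x\<in>S. c x} + card {x\<in>S. \<not> c x}" by (metis card_Un_le)
  then consider "n \<le> card {x\<in>S. c x}" | "n \<le> card {x\<in>S. \<not> c x}" using assms by linarith
  then show ?thesis
  proof cases
    case 1
    then obtain T where "T \<subseteq> {x\<in>S. c x}" "card T = n" by (meson obtain_subset_with_card_n)
    then show ?thesis by (intro exI[of _ T]) auto
  next
    case 2
    then obtain T where "T \<subseteq> {x\<in>S. \<not> c x}" "card T = n" by (meson obtain_subset_with_card_n)
    then show ?thesis by (intro exI[of _ T]) auto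
  qed
qed

section \<open>Two and three dimensions\<close>

text \<open>The slices are the rows \<open>y\<close>. The first factors of the bound count signed
  \<open>2 * a\<close>-subsets of \<open>A\<close>, and the exponent of \<open>b\<close> counts
  signed \<open>a\<close>-subsets of one of them. The sizes \<open>a\<close> and \<open>b\<close>
  are kept apart because the three-dimensional argument needs \<open>b\<close> exponentially larger
  than \<open>a\<close>.\<close>

lemma planar_monotone:
  fixes f :: "int \<Rightarrow> int \<Rightarrow> real"
  assumes fin: "finite A" "finite B" and inj: "inj_on (\<lambda>(x, y). f x y) (A \<times> B)"
    and a: "a \<ge> 1" and b: "b \<ge> 1" and A: "card A = (2 * a)\<^sup>2"
    and B: "2 * 2 ^ (2 * a)\<^sup>2 * b ^ (2 * 2 ^ (2 * a)) \<le> card B"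
  shows "\<exists>S\<subseteq>A. \<exists>T\<subseteq>B. card S = a \<and> card T = b \<and> (\<exists>u v.
    (\<forall>x\<in>S. \<forall>x'\<in>S. \<forall>y\<in>T. x < x' \<longrightarrow> less_dir u (f x y) (f x' y)) \<and>
    (\<forall>x\<in>S. \<forall>y\<in>T. \<forall>y'\<in>T. y < y' \<longrightarrow> less_dir v (f x y) (f x y')))"
proof -
  define sub where "sub S k = {S'. S' \<subseteq> S \<and> card S' = k}" for S :: "int set" and k
  define F where "F = sub A (2 * a) \<times> (UNIV :: bool set)"
  define P where "P K = sub (fst K) a \<times> (UNIV :: bool set)" for K :: "int set \<times> bool"
  define good where "good y K \<longleftrightarrow>
    (\<forall>x\<in>fst K. \<forall>x'\<in>fst K. x < x' \<longrightarrow> less_dir (snd K) (f x y) (f x' y))" for y K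
  define R where "R p y y' \<longleftrightarrow> (\<forall>x\<in>fst p. less_dir (snd p) (f x y) (f x y'))"
    for p :: "int set \<times> bool" and y y'
  have finsub: "finite (sub S k)" if "finite S" for S k
    using that by (simp add: sub_def)
  have "\<exists>K\<in>F. \<exists>p\<in>P K. \<exists>Y\<subseteq>B. card Y = b \<and> (\<forall>y\<in>Y. good y K) \<and>
    (\<forall>y\<in>Y. \<forall>y'\<in>Y. y < y' \<longrightarrow> R p y y')"
  proof (rule pigeonhole_chain)
    show "card F \<le> 2 * 2 ^ (2 * a)\<^sup>2"
      using card_sized_subsets_le[OF fin(1), of "2 * a"] A by (simp add: F_def sub_def card_cartesian_product)
    show "finite F" using finsub fin by (simp add: F_def)
    show "\<exists>K\<in>F. good y K" if "y \<in> B" for y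
    proof -
      have "inj_on (\<lambda>x. f x y) A" using inj that by (auto simp: inj_on_def)
      have "(2 * a)\<^sup>2 \<le> card A" "1 \<le> 2 * a" using A a by simp_all
      then obtain S u where "S \<subseteq> A" "card S = 2 * a"
        "\<forall>x\<in>S. \<forall>x'\<in>S. x < x' \<longrightarrow> less_dir u (f x y) (f x' y)"
        using erdos_szekeres[OF fin(1) \<open>inj_on _ A\<close>, of "2 * a"] by blast
      then show ?thesis by (intro bexI[of _ "(S, u)"]) (auto simp: F_def sub_def good_def)
    qed
    show "finite (P K) \<and> P K \<noteq> {} \<and> card (P K) \<le> 2 * 2 ^ (2 * a)" if "K \<in> F" for K
    proof -
      have "fst K \<subseteq> A" and K: "card (fst K) = 2 * a"
        using that by (auto simp: F_def sub_def)
      then have finK: "finite (fst K)" using fin finite_subset by blast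
      obtain S where "S \<subseteq> fst K" "card S = a"
        using obtain_subset_with_card_n[of a "fst K"] K by (metis le_add1 mult_2)
      then have "P K \<noteq> {}" by (auto simp: P_def sub_def)
      then show ?thesis
        using K finK finsub card_sized_subsets_le[OF finK, of a] by (simp add: P_def sub_def card_cartesian_product)
    qed
    show "\<exists>p\<in>P K. R p y y'" if "K \<in> F" "y \<in> B" "y' \<in> B" "y < y'" for K y y'
    proof -
      have K: "fst K \<subseteq> A" "card (fst K) = 2 * a" using that by (auto simp: F_def sub_def)
      \<comment> \<open>Two rows colour the \<open>2 * a\<close> columns by the truth of
        \<open><\<close>, and some colour occurs at least \<open>a\<close> times. Injectivity turns
        a failure of \<open><\<close> into the reverse strict inequality.\<close>
      then obtain T u where T: "T \<subseteq> fst K" "card T = a" "\<forall>x\<in>T. (f x y < f x y') = u"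
        using bool_pigeonhole[of a "fst K" "\<lambda>x. f x y < f x y'"] by auto
      have ne: "f x y \<noteq> f x y'" if "x \<in> T" for x
        using inj_onD[OF inj, of "(x, y)" "(x, y')"] that T K \<open>y \<in> B\<close> \<open>y' \<in> B\<close> \<open>y < y'\<close> by auto
      have "less_dir u (f x y) (f x y')" if "x \<in> T" for x
        using T(3) that ne[OF that] unfolding less_dir_def by (smt (verit))
      then show ?thesis using T by (intro bexI[of _ "(T, u)"]) (auto simp: P_def sub_def R_def)
    qed
    show "R p y y''" if "R p y y'" "R p y' y''" for p y y' y''
      using that less_dir_trans unfolding R_def by blast
    show "(1 :: nat) \<le> 2 * 2 ^ (2 * a)\<^sup>2" by simp
    show "2 * 2 ^ (2 * a)\<^sup>2 * b ^ (2 * 2 ^ (2 * a)) \<le> card B" by (rule B)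
  qed (use fin b in simp_all)
  then obtain K p Y where KpY: "K \<in> F" "p \<in> P K" "Y \<subseteq> B" "card Y = b"
    "\<forall>y\<in>Y. good y K" "\<forall>y\<in>Y. \<forall>y'\<in>Y. y < y' \<longrightarrow> R p y y'" by blast
  have K: "fst K \<subseteq> A" "fst p \<subseteq> fst K" "card (fst p) = a"
    using KpY(1,2) by (auto simp: F_def P_def sub_def)
  have "\<forall>x\<in>fst p. \<forall>x'\<in>fst p. \<forall>y\<in>Y. x < x' \<longrightarrow> less_dir (snd K) (f x y) (f x' y)"
    using KpY(5) K(2) unfolding good_def by blast
  moreover have "\<forall>x\<in>fst p. \<forall>y\<in>Y. \<forall>y'\<in>Y. y < y' \<longrightarrow> less_dir (snd p) (f x y) (f x y')"
    using KpY(6) unfolding R_def by blast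
  moreover have "fst p \<subseteq> A" using K by blast
  ultimately show ?thesis
    using K(3) KpY(3,4) by (intro exI[of _ "fst p"] exI[of _ Y] exI[of _ "snd K"] exI[of _ "snd p"] conjI)
qed

text \<open>Serves for small subsets of a huge set. In three dimensions the second side is so large
  that the bound \<open>2 ^ card A\<close> would cost a further exponential.\<close>

lemma card_sized_subsets_le_power:
  assumes "finite A" shows "card {S. S \<subseteq> A \<and> card S = k} \<le> card A ^ k"
  using assms by (cases "k \<le> card A") (simp_all add: n_subsets binomial_le_pow binomial_eq_0)

text \<open>Every \<open>y\<close> sees some colour on at least half of \<open>S\<close>, hence on
  an \<open>n\<close>-subset. There are at most \<open>2 * 2 ^ (2 * n)\<close> pairs of such a
  subset and a colour, so \<open>n\<close> of the \<open>y\<close> share one pair.\<close>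

lemma monochromatic_rectangle:
  fixes c :: "'a \<Rightarrow> int \<Rightarrow> bool"
  assumes S: "finite S" "card S = 2 * n" and T: "finite T" "2 * 2 ^ (2 * n) * n \<le> card T" and n: "n \<ge> 1"
  shows "\<exists>S'\<subseteq>S. \<exists>T'\<subseteq>T. card S' = n \<and> card T' = n \<and> (\<exists>u. \<forall>x\<in>S'. \<forall>y\<in>T'. c x y = u)"
proof -
  define F where "F = {S'. S' \<subseteq> S \<and> card S' = n} \<times> (UNIV :: bool set)"
  define good where "good y K \<longleftrightarrow> (\<forall>x\<in>fst K. c x y = snd K)" for y K
  \<comment> \<open>No order relation is needed between the chosen columns, so the only pattern is
    \<open>()\<close> and the exponent is 1.\<close>
  have "\<exists>K\<in>F. \<exists>p\<in>{()}. \<exists>Y\<subseteq>T. card Y = n \<and> (\<forall>y\<in>Y. good y K) \<and> (\<forall>y\<in>Y. \<forall>y'\<in>Y. y < y' \<longrightarrow> True)"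
  proof (rule pigeonhole_chain)
    show "finite F" using S by (simp add: F_def)
    show "card F \<le> 2 * 2 ^ (2 * n)"
      using card_sized_subsets_le[OF S(1), of n] S(2) by (simp add: F_def card_cartesian_product)
    show "\<exists>K\<in>F. good y K" for y
    proof -
      obtain T u where "T \<subseteq> S" "card T = n" "\<forall>x\<in>T. c x y = u"
        using bool_pigeonhole[of n S "\<lambda>x. c x y"] S by auto
      then show ?thesis by (intro bexI[of _ "(T, u)"]) (auto simp: F_def good_def)
    qed
    show "2 * 2 ^ (2 * n) * n ^ 1 \<le> card T" using T by simp
  qed (use n T in auto)
  then obtain K Y where "K \<in> F" "Y \<subseteq> T" "card Y = n" "\<forall>y\<in>Y. good y K" by blast
  then show ?thesis
    by (intro exI[of _ "fst K"] exI[of _ Y]) (auto simp: F_def good_def)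
qed

section \<open>Explicit bounds and the three-dimensional argument\<close>

definition planar_bound :: "nat \<Rightarrow> nat \<Rightarrow> nat" where
  "planar_bound a b = 2 * 2 ^ (2 * a)\<^sup>2 * b ^ (2 * 2 ^ (2 * a))"

definition rectangle_bound :: "nat \<Rightarrow> nat" where
  "rectangle_bound n = 2 * 2 ^ (2 * n) * n"

text \<open>The factor 4 counts the direction pairs of a planar slice, the next two count its
  possible sides inside sets of size \<open>(4 * n) ^ 2\<close> and \<open>r\<close>, and the
  exponent of \<open>n\<close> counts signed \<open>n\<close> by \<open>n\<close> subrectangles of a
  \<open>2 * n\<close> by \<open>b\<close> rectangle.\<close>

definition spatial_bound :: "nat \<Rightarrow> nat" where
  "spatial_bound n = (let b = rectangle_bound n; r = planar_bound (2 * n) b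
     in 4 * 2 ^ (2 * (2 * n))\<^sup>2 * r ^ b * n ^ (2 * 2 ^ (2 * n) * b ^ n))"

text \<open>The slices are the planes of constant \<open>z\<close>, each treated by
  \<open>planar_monotone\<close>. The first two sides have prescribed cardinalities so that the
  rectangles in them can be counted; only the third is merely large.\<close>

lemma spatial_monotone:
  fixes f :: "int \<Rightarrow> int \<Rightarrow> int \<Rightarrow> real"
  assumes fin: "finite A" "finite B" "finite C"
    and inj: "inj_on (\<lambda>(x, y, z). f x y z) (A \<times> B \<times> C)"
    and n: "n \<ge> 1" and A: "card A = (2 * (2 * n))\<^sup>2"
    and B: "card B = planar_bound (2 * n) (rectangle_bound n)"
    and C: "spatial_bound n \<le> card C"
  shows "\<exists>S\<subseteq>A. \<exists>T\<subseteq>B. \<exists>U\<subseteq>C. card S = n \<and> card T = n \<and> card U = n \<and> (\<exists>u v w.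
    (\<forall>x\<in>S. \<forall>x'\<in>S. \<forall>y\<in>T. \<forall>z\<in>U. x < x' \<longrightarrow> less_dir u (f x y z) (f x' y z)) \<and>
    (\<forall>x\<in>S. \<forall>y\<in>T. \<forall>y'\<in>T. \<forall>z\<in>U. y < y' \<longrightarrow> less_dir v (f x y z) (f x y' z)) \<and>
    (\<forall>x\<in>S. \<forall>y\<in>T. \<forall>z\<in>U. \<forall>z'\<in>U. z < z' \<longrightarrow> less_dir w (f x y z) (f x y z')))"
proof -
  define b where "b = rectangle_bound n"
  define r where "r = planar_bound (2 * n) b"
  define sub where "sub S k = {S'. S' \<subseteq> S \<and> card S' = k}" for S :: "int set" and k
  define F where "F = (sub A (2 * n) \<times> sub B b) \<times> (UNIV :: (bool \<times> bool) set)"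
  define P where "P K = (sub (fst (fst K)) n \<times> sub (snd (fst K)) n) \<times> (UNIV :: bool set)"
    for K :: "(int set \<times> int set) \<times> (bool \<times> bool)"
  define good where "good z K \<longleftrightarrow> (case K of ((S, T), (u, v)) \<Rightarrow>
    (\<forall>x\<in>S. \<forall>x'\<in>S. \<forall>y\<in>T. x < x' \<longrightarrow> less_dir u (f x y z) (f x' y z)) \<and>
    (\<forall>x\<in>S. \<forall>y\<in>T. \<forall>y'\<in>T. y < y' \<longrightarrow> less_dir v (f x y z) (f x y' z)))" for z K
  define R where "R p z z' \<longleftrightarrow>
    (\<forall>x\<in>fst (fst p). \<forall>y\<in>snd (fst p). less_dir (snd p) (f x y z) (f x y z'))"
    for p :: "(int set \<times> int set) \<times> bool" and z z'
  have finsub: "finite (sub S k)" if "finite S" for S k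
    using that by (simp add: sub_def)
  have b: "b \<ge> 1" "b \<ge> n" using n by (simp_all add: b_def rectangle_bound_def)
  have KF: "S \<subseteq> A" "T \<subseteq> B" "card S = 2 * n" "card T = b" "finite S" "finite T"
    if "((S, T), uv) \<in> F" for S T uv
    using that fin by (auto simp: F_def sub_def intro: finite_subset)
  have "\<exists>K\<in>F. \<exists>p\<in>P K. \<exists>Z\<subseteq>C. card Z = n \<and> (\<forall>z\<in>Z. good z K) \<and>
    (\<forall>z\<in>Z. \<forall>z'\<in>Z. z < z' \<longrightarrow> R p z z')"
  proof (rule pigeonhole_chain)
    \<comment> \<open>The second side is counted by \<open>r ^ b\<close> and not by
      \<open>2 ^ r\<close>, which keeps the result doubly exponential.\<close>
    have "card F = 4 * (card (sub A (2 * n)) * card (sub B b))"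
      unfolding F_def card_cartesian_product by (simp add: card_UNIV_bool flip: UNIV_Times_UNIV)
    also have "\<dots> \<le> 4 * (2 ^ (2 * (2 * n))\<^sup>2 * r ^ b)"
      using card_sized_subsets_le[OF fin(1), of "2 * n"] card_sized_subsets_le_power[OF fin(2), of b]
      unfolding A B sub_def r_def b_def by (intro mult_le_mono order.refl)
    finally show "card F \<le> 4 * 2 ^ (2 * (2 * n))\<^sup>2 * r ^ b" by simp
    show "finite F" using finsub fin by (simp add: F_def)
    show "\<exists>K\<in>F. good z K" if "z \<in> C" for z
    proof -
      have "inj_on (\<lambda>(x, y). f x y z) (A \<times> B)"
        using inj that unfolding inj_on_def by auto
      then obtain S T u v where "S \<subseteq> A" "T \<subseteq> B" "card S = 2 * n" "card T = b"
        "\<forall>x\<in>S. \<forall>x'\<in>S. \<forall>y\<in>T. x < x' \<longrightarrow> less_dir u (f x y z) (f x' y z)"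
        "\<forall>x\<in>S. \<forall>y\<in>T. \<forall>y'\<in>T. y < y' \<longrightarrow> less_dir v (f x y z) (f x y' z)"
        using planar_monotone[OF fin(1,2), of "\<lambda>x y. f x y z" "2 * n" b] A B n b
        unfolding planar_bound_def b_def[symmetric] by auto
      then show ?thesis
        by (intro bexI[of _ "((S, T), (u, v))"]) (simp_all add: F_def sub_def good_def)
    qed
    show "finite (P K) \<and> P K \<noteq> {} \<and> card (P K) \<le> 2 * 2 ^ (2 * n) * b ^ n" if "K \<in> F" for K
    proof -
      obtain S T uv where K: "K = ((S, T), uv)" by (metis surj_pair)
      note KF' = KF[OF that[unfolded K]]
      obtain S' where S': "S' \<subseteq> S" "card S' = n"
        using obtain_subset_with_card_n[of n S] KF'(3) by (metis le_add1 mult_2)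
      obtain T' where T': "T' \<subseteq> T" "card T' = n"
        using obtain_subset_with_card_n[of n T] KF'(4) b by metis
      have "((S', T'), True) \<in> P K" using S' T' by (simp add: P_def K sub_def)
      moreover have "finite (P K)" using KF' finsub by (simp add: P_def K)
      moreover have "card (P K) = 2 * (card (sub S n) * card (sub T n))"
        by (simp add: P_def K card_cartesian_product)
      moreover have "\<dots> \<le> 2 * (2 ^ (2 * n) * b ^ n)"
        using card_sized_subsets_le[OF KF'(5), of n] card_sized_subsets_le_power[OF KF'(6), of n] KF'(3,4)
        unfolding sub_def by (intro mult_le_mono order.refl) simp_all
      ultimately show ?thesis by auto
    qed
    show "\<exists>p\<in>P K. R p z z'" if "K \<in> F" "z \<in> C" "z' \<in> C" "z < z'" for K z z'
    proof -
      obtain S T uv where K: "K = ((S, T), uv)" by (metis surj_pair)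
      note KF' = KF[OF that(1)[unfolded K]]
      have "2 * 2 ^ (2 * n) * n \<le> card T"
        using KF'(4) by (simp add: b_def rectangle_bound_def)
      \<comment> \<open>Two planes 2-colour the rectangle \<open>S \<times> T\<close> according to
        which has the larger entry; a monochromatic \<open>n\<close> by \<open>n\<close> part is a
        pattern.\<close>
      from monochromatic_rectangle[OF KF'(5,3,6) this n, of "\<lambda>x y. f x y z < f x y z'"]
      obtain S' T' u where ST: "S' \<subseteq> S" "T' \<subseteq> T" "card S' = n" "card T' = n"
        "\<forall>x\<in>S'. \<forall>y\<in>T'. (f x y z < f x y z') = u"
        by blast
      have ne: "f x y z \<noteq> f x y z'" if "x \<in> S'" "y \<in> T'" for x y
        using inj_onD[OF inj, of "(x, y, z)" "(x, y, z')"] that ST(1,2) KF'(1,2)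
          \<open>z \<in> C\<close> \<open>z' \<in> C\<close> \<open>z < z'\<close> by auto
      have "less_dir u (f x y z) (f x y z')" if "x \<in> S'" "y \<in> T'" for x y
        using ST(5) that ne[OF that] unfolding less_dir_def by (smt (verit))
      then show ?thesis
        using ST by (intro bexI[of _ "((S', T'), u)"]) (simp_all add: P_def sub_def R_def K)
    qed
    show "R p z z''" if "R p z z'" "R p z' z''" for p z z' z''
      using that less_dir_trans unfolding R_def by blast
    have "r \<ge> 1" using b by (simp add: r_def planar_bound_def)
    then show "1 \<le> 4 * 2 ^ (2 * (2 * n))\<^sup>2 * r ^ b" by simp
    show "4 * 2 ^ (2 * (2 * n))\<^sup>2 * r ^ b * n ^ (2 * 2 ^ (2 * n) * b ^ n) \<le> card C"
      using C unfolding spatial_bound_def Let_def r_def b_def .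
  qed (use fin n in simp_all)
  then obtain K p Z where KpZ: "K \<in> F" "p \<in> P K" "Z \<subseteq> C" "card Z = n"
    "\<forall>z\<in>Z. good z K" "\<forall>z\<in>Z. \<forall>z'\<in>Z. z < z' \<longrightarrow> R p z z'" by blast
  obtain S T u v where K: "K = ((S, T), (u, v))" by (metis surj_pair)
  obtain S' T' w where p: "p = ((S', T'), w)" by (metis surj_pair)
  have sub: "S' \<subseteq> S" "T' \<subseteq> T" "card S' = n" "card T' = n"
    using KpZ(2) by (auto simp: P_def K p sub_def)
  note KF' = KF[OF KpZ(1)[unfolded K]]
  have "\<forall>z\<in>Z. \<forall>x\<in>S. \<forall>x'\<in>S. \<forall>y\<in>T. x < x' \<longrightarrow> less_dir u (f x y z) (f x' y z)"
    "\<forall>z\<in>Z. \<forall>x\<in>S. \<forall>y\<in>T. \<forall>y'\<in>T. y < y' \<longrightarrow> less_dir v (f x y z) (f x y' z)"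
    using KpZ(5) by (simp_all add: good_def K)
  then have "\<forall>x\<in>S'. \<forall>x'\<in>S'. \<forall>y\<in>T'. \<forall>z\<in>Z. x < x' \<longrightarrow> less_dir u (f x y z) (f x' y z)"
    "\<forall>x\<in>S'. \<forall>y\<in>T'. \<forall>y'\<in>T'. \<forall>z\<in>Z. y < y' \<longrightarrow> less_dir v (f x y z) (f x y' z)"
    using sub(1,2) by (meson subsetD)+
  moreover have "\<forall>x\<in>S'. \<forall>y\<in>T'. \<forall>z\<in>Z. \<forall>z'\<in>Z. z < z' \<longrightarrow> less_dir w (f x y z) (f x y z')"
    using KpZ(6) by (simp add: R_def p)
  moreover have "S' \<subseteq> A" "T' \<subseteq> B" using sub KF' by blast+
  ultimately show ?thesis
    using sub(3,4) KpZ(3,4)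
    by (intro exI[of _ S'] exI[of _ T'] exI[of _ Z] exI[of _ u] exI[of _ v] exI[of _ w] conjI)
qed

section \<open>From coordinate functions of two and three variables to arrays\<close>

lemma forces_monotoneI:
  assumes n: "n \<ge> 1"
    and ex: "\<And>A f. is_array d A f \<Longrightarrow> has_cubic_size d A N \<Longrightarrow>
      \<exists>B. (\<forall>i\<in>{1..d}. B i \<subseteq> A i \<and> card (B i) = n) \<and>
        (\<forall>i\<in>{1..d}. \<exists>u. \<forall>a\<in>grid d B. \<forall>x\<in>B i. \<forall>y\<in>B i. x < y \<longrightarrow>
          less_dir u (f (a(i := x))) (f (a(i := y))))"
  shows "forces_monotone d n N"
  unfolding forces_monotone_def
proof (intro allI impI, elim conjE)
  fix A f assume "is_array d A f" "has_cubic_size d A N"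
  from ex[OF this] obtain B where B: "\<forall>i\<in>{1..d}. B i \<subseteq> A i \<and> card (B i) = n"
    and mono: "\<And>i. i \<in> {1..d} \<Longrightarrow> \<exists>u. \<forall>a\<in>grid d B. \<forall>x\<in>B i. \<forall>y\<in>B i. x < y \<longrightarrow>
          less_dir u (f (a(i := x))) (f (a(i := y)))" by blast
  define g where "g = restrict f (grid d B)"
  \<comment> \<open>Overwriting a coordinate by an element of its side stays inside the grid, where
    the restriction \<open>g\<close> agrees with \<open>f\<close>.\<close>
  have g: "g (a(i := x)) = f (a(i := x))" if "i \<in> {1..d}" "a \<in> grid d B" "x \<in> B i" for a i x
  proof -
    have "a(i := x) \<in> grid d B"
      using that by (auto simp: grid_def PiE_iff extensional_def)
    then show ?thesis by (simp add: g_def)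
  qed
  have "monotone_array d B g"
    unfolding monotone_array_def
  proof
    fix i assume i: "i \<in> {1..d}"
    then obtain u where "\<forall>a\<in>grid d B. \<forall>x\<in>B i. \<forall>y\<in>B i. x < y \<longrightarrow>
          less_dir u (f (a(i := x))) (f (a(i := y)))" using mono by blast
    then show "(\<forall>a\<in>grid d B. strict_mono_on (B i) (\<lambda>x. g (a(i := x)))) \<or>
        (\<forall>a\<in>grid d B. strict_antimono_on (B i) (\<lambda>x. g (a(i := x))))"
      by (cases u) (simp_all add: monotone_on_def less_dir_def g[OF i] cong: ball_cong)
  qed
  moreover have "B i \<noteq> {}" if "i \<in> {1..d}" for i
    using B n that by (metis card.empty not_one_le_zero)
  ultimately show "\<exists>B g. is_subarray d B g A f \<and> has_cubic_size d B n \<and> monotone_array d B g"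
    using B by (intro exI[of _ B] exI[of _ g]) (auto simp: is_subarray_def has_cubic_size_def g_def)
qed

lemma atLeastAtMost_1_2: "{1..2} = {1, 2 :: nat}"
  and atLeastAtMost_1_3: "{1..3} = {1, 2, 3 :: nat}"
  by auto

lemma forces_monotone_2:
  assumes n: "n \<ge> 1"
  shows "forces_monotone 2 n (planar_bound n n)"
proof (rule forces_monotoneI[OF n])
  fix A f assume arr: "is_array 2 A f" and size: "has_cubic_size 2 A (planar_bound n n)"
  have A: "finite (A 1)" "finite (A 2)" "card (A 1) = planar_bound n n" "card (A 2) = planar_bound n n"
    and inj: "inj_on f (grid 2 A)"
    using arr size by (auto simp: is_array_def has_cubic_size_def)
  \<comment> \<open>The value \<open>undefined\<close> off the indices 1 and 2 makes
    \<open>pt x y\<close> extensional, as the points of a grid are.\<close>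
  define pt :: "int \<Rightarrow> int \<Rightarrow> nat \<Rightarrow> int" where "pt x y = (\<lambda>_. undefined)(1 := x, 2 := y)" for x y
  have grid2: "a \<in> grid 2 B \<longleftrightarrow> (\<exists>x\<in>B 1. \<exists>y\<in>B 2. a = pt x y)" for a B
  proof
    assume "a \<in> grid 2 B"
    then have "a 1 \<in> B 1" "a 2 \<in> B 2" "a \<in> extensional {1, 2}"
      unfolding grid_def atLeastAtMost_1_2 PiE_iff by simp_all
    moreover from this have "a = pt (a 1) (a 2)"
      by (auto simp: pt_def extensional_def fun_eq_iff)
    ultimately show "\<exists>x\<in>B 1. \<exists>y\<in>B 2. a = pt x y" by blast
  next
    assume "\<exists>x\<in>B 1. \<exists>y\<in>B 2. a = pt x y"
    then show "a \<in> grid 2 B"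
      unfolding grid_def atLeastAtMost_1_2 PiE_iff by (auto simp: pt_def extensional_def)
  qed
  have pt_simps: "pt x y 1 = x" "pt x y 2 = y" for x y by (simp_all add: pt_def)
  have pt_eq: "pt x y = pt x' y' \<longleftrightarrow> x = x' \<and> y = y'" for x y x' y'
    by (metis pt_simps)
  have upd: "(pt x y)(1 := z) = pt z y" "(pt x y)(2 := z) = pt x z" for x y z
    by (auto simp: pt_def fun_eq_iff)
  have "(2 * n)\<^sup>2 < 2 ^ (2 * n)\<^sup>2" by (rule less_exp)
  also have "\<dots> \<le> planar_bound n n" using n by (simp add: planar_bound_def)
  \<comment> \<open>\<open>planar_monotone\<close> asks for a first side of exactly this size, so
    that side is cut down while the second stays whole.\<close>
  finally obtain A1 where A1: "A1 \<subseteq> A 1" "card A1 = (2 * n)\<^sup>2"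
    using A(3) obtain_subset_with_card_n by (metis less_imp_le)
  have "inj_on (\<lambda>(x, y). f (pt x y)) (A1 \<times> A 2)"
  proof (rule inj_onI, clarify)
    fix x y x' y' assume "x \<in> A1" "y \<in> A 2" "x' \<in> A1" "y' \<in> A 2" "f (pt x y) = f (pt x' y')"
    then have "pt x y = pt x' y'" using A1(1) by (intro inj_onD[OF inj]) (auto simp: grid2)
    then show "x = x' \<and> y = y'" by (simp add: pt_eq)
  qed
  then obtain S T u v where S: "S \<subseteq> A1" "T \<subseteq> A 2" "card S = n" "card T = n"
    and mono: "\<forall>x\<in>S. \<forall>x'\<in>S. \<forall>y\<in>T. x < x' \<longrightarrow> less_dir u (f (pt x y)) (f (pt x' y))"
      "\<forall>x\<in>S. \<forall>y\<in>T. \<forall>y'\<in>T. y < y' \<longrightarrow> less_dir v (f (pt x y)) (f (pt x y'))"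
    using planar_monotone[OF finite_subset[OF A1(1) A(1)] A(2), of "\<lambda>x y. f (pt x y)" n n] n A A1(2)
    unfolding planar_bound_def by auto
  define B where "B i = (if i = (1::nat) then S else T)" for i
  have B12: "B 1 = S" "B 2 = T" by (simp_all add: B_def)
  have "S \<subseteq> A 1" using S A1 by blast
  have sub: "\<forall>i\<in>{1..2}. B i \<subseteq> A i \<and> card (B i) = n"
    using S \<open>S \<subseteq> A 1\<close> unfolding atLeastAtMost_1_2 by (simp add: B_def)
  show "\<exists>B. (\<forall>i\<in>{1..2}. B i \<subseteq> A i \<and> card (B i) = n) \<and>
        (\<forall>i\<in>{1..2}. \<exists>u. \<forall>a\<in>grid 2 B. \<forall>x\<in>B i. \<forall>y\<in>B i. x < y \<longrightarrow>
          less_dir u (f (a(i := x))) (f (a(i := y))))"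
  proof (intro exI[of _ B] conjI ballI)
    fix i :: nat assume "i \<in> {1..2}"
    then consider "i = 1" | "i = 2" by force
    then show "\<exists>u. \<forall>a\<in>grid 2 B. \<forall>x\<in>B i. \<forall>y\<in>B i. x < y \<longrightarrow>
          less_dir u (f (a(i := x))) (f (a(i := y)))"
    proof cases
      case 1 show ?thesis by (rule exI[of _ u]) (use mono(1) in \<open>auto simp: 1 grid2 B12 upd simp del: One_nat_def\<close>)
    next
      case 2 show ?thesis by (rule exI[of _ v]) (use mono(2) in \<open>auto simp: 2 grid2 B12 upd simp del: One_nat_def\<close>)
    qed
  qed (use sub in blast)+
qed

lemma forces_monotone_3:
  assumes n: "n \<ge> 1"
  shows "forces_monotone 3 n (spatial_bound n)"
proof (rule forces_monotoneI[OF n])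
  fix A f assume arr: "is_array 3 A f" and size: "has_cubic_size 3 A (spatial_bound n)"
  have A: "finite (A 1)" "finite (A 2)" "finite (A 3)" "card (A 1) = spatial_bound n"
      "card (A 2) = spatial_bound n" "card (A 3) = spatial_bound n"
    and inj: "inj_on f (grid 3 A)"
    using arr size by (auto simp: is_array_def has_cubic_size_def)
  define pt :: "int \<Rightarrow> int \<Rightarrow> int \<Rightarrow> nat \<Rightarrow> int" where
    "pt x y z = (\<lambda>_. undefined)(1 := x, 2 := y, 3 := z)" for x y z
  have grid3: "a \<in> grid 3 B \<longleftrightarrow> (\<exists>x\<in>B 1. \<exists>y\<in>B 2. \<exists>z\<in>B 3. a = pt x y z)" for a B
  proof
    assume "a \<in> grid 3 B"
    then have "a 1 \<in> B 1" "a 2 \<in> B 2" "a 3 \<in> B 3" "a \<in> extensional {1, 2, 3}"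
      unfolding grid_def atLeastAtMost_1_3 PiE_iff by simp_all
    moreover from this have "a = pt (a 1) (a 2) (a 3)"
      by (auto simp: pt_def extensional_def fun_eq_iff)
    ultimately show "\<exists>x\<in>B 1. \<exists>y\<in>B 2. \<exists>z\<in>B 3. a = pt x y z" by blast
  next
    assume "\<exists>x\<in>B 1. \<exists>y\<in>B 2. \<exists>z\<in>B 3. a = pt x y z"
    then show "a \<in> grid 3 B"
      unfolding grid_def atLeastAtMost_1_3 PiE_iff by (auto simp: pt_def extensional_def)
  qed
  have pt_simps: "pt x y z 1 = x" "pt x y z 2 = y" "pt x y z 3 = z" for x y z
    by (simp_all add: pt_def)
  have pt_eq: "pt x y z = pt x' y' z' \<longleftrightarrow> x = x' \<and> y = y' \<and> z = z'" for x y z x' y' z'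
    by (metis pt_simps)
  have upd: "(pt x y z)(1 := t) = pt t y z" "(pt x y z)(2 := t) = pt x t z"
    "(pt x y z)(3 := t) = pt x y t" for x y z t
    by (auto simp: pt_def fun_eq_iff)
  define b where "b = rectangle_bound n"
  define r where "r = planar_bound (2 * n) b"
  have b: "b \<ge> 1" using n by (simp add: b_def rectangle_bound_def)
  then have r: "r \<ge> 1" by (simp add: r_def planar_bound_def)
  have s: "4 * 2 ^ (2 * (2 * n))\<^sup>2 * r ^ b \<le> spatial_bound n"
    unfolding spatial_bound_def Let_def b_def r_def using n by simp
  have "(2 * (2 * n))\<^sup>2 < 2 ^ (2 * (2 * n))\<^sup>2" by (rule less_exp)
  also have "\<dots> \<le> 4 * 2 ^ (2 * (2 * n))\<^sup>2 * r ^ b" using r by simp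
  \<comment> \<open>Both trimmed sizes lie below \<open>spatial_bound n\<close>, because the latter
    contains \<open>2 ^ (2 * (2 * n))\<^sup>2\<close> and \<open>r ^ b\<close> as factors.\<close>
  finally have "(2 * (2 * n))\<^sup>2 \<le> card (A 1)" using s A(4) by linarith
  then obtain A1 where A1: "A1 \<subseteq> A 1" "card A1 = (2 * (2 * n))\<^sup>2"
    using obtain_subset_with_card_n by metis
  have "r = r ^ 1" by simp
  also have "\<dots> \<le> r ^ b" using r b by (intro power_increasing)
  also have "\<dots> \<le> 4 * 2 ^ (2 * (2 * n))\<^sup>2 * r ^ b" by simp
  finally have "r \<le> card (A 2)" using s A(5) by linarith
  then obtain A2 where A2: "A2 \<subseteq> A 2" "card A2 = r"
    using obtain_subset_with_card_n by metis
  have "inj_on (\<lambda>(x, y, z). f (pt x y z)) (A1 \<times> A2 \<times> A 3)"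
  proof (rule inj_onI, clarify)
    fix x y z x' y' z' assume "x \<in> A1" "y \<in> A2" "z \<in> A 3" "x' \<in> A1" "y' \<in> A2" "z' \<in> A 3"
      "f (pt x y z) = f (pt x' y' z')"
    then have "pt x y z = pt x' y' z'"
      using A1(1) A2(1) by (intro inj_onD[OF inj]) (auto simp: grid3)
    then show "x = x' \<and> (y, z) = (y', z')" by (simp add: pt_eq)
  qed
  then obtain S T U u v w where S: "S \<subseteq> A1" "T \<subseteq> A2" "U \<subseteq> A 3" "card S = n" "card T = n" "card U = n"
    and mono: "\<forall>x\<in>S. \<forall>x'\<in>S. \<forall>y\<in>T. \<forall>z\<in>U. x < x' \<longrightarrow> less_dir u (f (pt x y z)) (f (pt x' y z))"
      "\<forall>x\<in>S. \<forall>y\<in>T. \<forall>y'\<in>T. \<forall>z\<in>U. y < y' \<longrightarrow> less_dir v (f (pt x y z)) (f (pt x y' z))"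
      "\<forall>x\<in>S. \<forall>y\<in>T. \<forall>z\<in>U. \<forall>z'\<in>U. z < z' \<longrightarrow> less_dir w (f (pt x y z)) (f (pt x y z'))"
    using spatial_monotone[OF finite_subset[OF A1(1) A(1)] finite_subset[OF A2(1) A(2)] A(3),
        of "\<lambda>x y z. f (pt x y z)" n] n A(6) A1(2) A2(2)
    unfolding r_def b_def by auto
  define B where "B i = (if i = (1::nat) then S else if i = 2 then T else U)" for i
  have B123: "B 1 = S" "B 2 = T" "B 3 = U" by (simp_all add: B_def)
  have "S \<subseteq> A 1" "T \<subseteq> A 2" using S A1 A2 by blast+
  have sub: "\<forall>i\<in>{1..3}. B i \<subseteq> A i \<and> card (B i) = n"
    using S \<open>S \<subseteq> A 1\<close> \<open>T \<subseteq> A 2\<close> unfolding atLeastAtMost_1_3 by (simp add: B_def)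
  show "\<exists>B. (\<forall>i\<in>{1..3}. B i \<subseteq> A i \<and> card (B i) = n) \<and>
        (\<forall>i\<in>{1..3}. \<exists>u. \<forall>a\<in>grid 3 B. \<forall>x\<in>B i. \<forall>y\<in>B i. x < y \<longrightarrow>
          less_dir u (f (a(i := x))) (f (a(i := y))))"
  proof (intro exI[of _ B] conjI ballI)
    fix i :: nat assume "i \<in> {1..3}"
    then consider "i = 1" | "i = 2" | "i = 3" by force
    then show "\<exists>u. \<forall>a\<in>grid 3 B. \<forall>x\<in>B i. \<forall>y\<in>B i. x < y \<longrightarrow>
          less_dir u (f (a(i := x))) (f (a(i := y)))"
    proof cases
      case 1 show ?thesis by (rule exI[of _ u]) (use mono(1) in \<open>auto simp: 1 grid3 B123 upd simp del: One_nat_def\<close>)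
    next
      case 2 show ?thesis by (rule exI[of _ v]) (use mono(2) in \<open>auto simp: 2 grid3 B123 upd simp del: One_nat_def\<close>)
    next
      case 3 show ?thesis by (rule exI[of _ w]) (use mono(3) in \<open>auto simp: 3 grid3 B123 upd simp del: One_nat_def\<close>)
    qed
  qed (use sub in blast)+
qed

section \<open>Subarrays with monotone lines\<close>

lemma atLeastAtMost_Suc_insert: "{1..Suc d} = insert (Suc d) {1..d}"
  by auto

lemma grid_Suc_iff:
  "a \<in> grid (Suc d) B \<longleftrightarrow> (\<exists>b\<in>grid d B. \<exists>x\<in>B (Suc d). a = b(Suc d := x))"
  unfolding grid_def atLeastAtMost_Suc_insert PiE_insert_eq by auto

lemma grid_cong: "(\<And>i. i \<in> {1..d} \<Longrightarrow> A i = B i) \<Longrightarrow> grid d A = grid d B"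
  unfolding grid_def by (rule PiE_cong)

lemma grid_mono: "(\<And>i. i \<in> {1..d} \<Longrightarrow> A i \<subseteq> B i) \<Longrightarrow> grid d A \<subseteq> grid d B"
  unfolding grid_def by (rule PiE_mono)

lemma grid_Suc_fun_upd [simp]: "grid d (B(Suc d := Y)) = grid d B"
  by (rule grid_cong) auto

text \<open>Families of sides are taken extensional, so that there are finitely many and they can
  serve as pigeonholes.\<close>

definition subgrids :: "nat \<Rightarrow> (nat \<Rightarrow> int set) \<Rightarrow> nat \<Rightarrow> (nat \<Rightarrow> int set) set" where
  "subgrids d A n = Pi\<^sub>E {1..d} (\<lambda>i. {S. S \<subseteq> A i \<and> card S = n})"

lemma subgridsD:
  assumes "B \<in> subgrids d A n" "i \<in> {1..d}"
  shows "B i \<subseteq> A i" "card (B i) = n"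
  using assms by (auto simp: subgrids_def PiE_iff)

lemma subgrids_mono: "(\<And>i. i \<in> {1..d} \<Longrightarrow> A i \<subseteq> A' i) \<Longrightarrow> subgrids d A n \<subseteq> subgrids d A' n"
  unfolding subgrids_def by (rule PiE_mono) auto

lemma subgrids_SucI:
  assumes "B \<in> subgrids d A n" "Y \<subseteq> A (Suc d)" "card Y = n"
  shows "B(Suc d := Y) \<in> subgrids (Suc d) A n"
  using assms unfolding subgrids_def atLeastAtMost_Suc_insert PiE_insert_eq by auto

lemma finite_subgrids: "(\<And>i. i \<in> {1..d} \<Longrightarrow> finite (A i)) \<Longrightarrow> finite (subgrids d A n)"
  unfolding subgrids_def by (intro finite_PiE) auto

lemma card_subgrids:
  assumes "\<And>i. i \<in> {1..d} \<Longrightarrow> finite (A i)" "\<And>i. i \<in> {1..d} \<Longrightarrow> card (A i) = r"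
  shows "card (subgrids d A n) = (r choose n) ^ d"
proof -
  have "card (subgrids d A n) = (\<Prod>i\<in>{1..d}. card {S. S \<subseteq> A i \<and> card S = n})"
    unfolding subgrids_def by (simp add: card_PiE)
  also have "\<dots> = (\<Prod>i\<in>{1..d}. r choose n)"
    using assms by (intro prod.cong) (auto simp: n_subsets)
  finally show ?thesis by simp
qed

lemma finite_grid: "(\<And>i. i \<in> {1..d} \<Longrightarrow> finite (A i)) \<Longrightarrow> finite (grid d A)"
  unfolding grid_def by (intro finite_PiE) auto

lemma card_grid: "(\<And>i. i \<in> {1..d} \<Longrightarrow> card (A i) = n) \<Longrightarrow> card (grid d A) = n ^ d"
  unfolding grid_def by (simp add: card_PiE)

text \<open>Cutting all sides to the same exact size bounds the number of subgrids independently of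
  the original array.\<close>

lemma ex_trimmed_sides:
  assumes "\<And>i. i \<in> {1..d} \<Longrightarrow> finite (A i) \<and> r \<le> card (A i)"
  shows "\<exists>A'. \<forall>i\<in>{1..d}. A' i \<subseteq> A i \<and> finite (A' i) \<and> card (A' i) = r"
proof -
  have "\<forall>i\<in>{1..d}. \<exists>S\<subseteq>A i. finite S \<and> card S = r"
    using assms by (meson obtain_subset_with_card_n finite_subset)
  then show ?thesis by metis
qed

text \<open>The direction \<open>u\<close> is chosen after the point \<open>a\<close>, so parallel
  lines may run in different directions; in \<open>monotone_array\<close> they may not.\<close>

definition line_monotone :: "nat \<Rightarrow> (nat \<Rightarrow> int set) \<Rightarrow> ((nat \<Rightarrow> int) \<Rightarrow> real) \<Rightarrow> bool" where
  "line_monotone d B f \<longleftrightarrow> (\<forall>i\<in>{1..d}. \<forall>a\<in>grid d B. \<exists>u. \<forall>x\<in>B i. \<forall>y\<in>B i.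
     x < y \<longrightarrow> less_dir u (f (a(i := x))) (f (a(i := y))))"

text \<open>The first factor bounds the number of subgrids of side \<open>s\<close> in a grid of
  side \<open>line_bound s d\<close>; the exponent \<open>2 ^ (s ^ d)\<close> is the number of sign
  functions on one such subgrid.\<close>

primrec line_bound :: "nat \<Rightarrow> nat \<Rightarrow> nat" where
  "line_bound s 0 = 1"
| "line_bound s (Suc d) = line_bound s d ^ (s * d) * s ^ (2 ^ (s ^ d))"

lemma line_bound_ge_1: "s \<ge> 1 \<Longrightarrow> line_bound s d \<ge> 1"
  by (induction d) auto

lemma line_bound_mono:
  assumes "s \<ge> 1" shows "line_bound s d \<le> line_bound s (Suc d)"
proof (cases "d = 0")
  case False
  have "line_bound s d = line_bound s d ^ 1 * 1" by simp
  also have "\<dots> \<le> line_bound s d ^ (s * d) * s ^ (2 ^ (s ^ d))"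
    using assms line_bound_ge_1[OF assms] False by (intro mult_le_mono power_increasing) auto
  finally show ?thesis by simp
qed (use assms in simp)

text \<open>Induction on the dimension, with slices along the last coordinate. Since every sign
  function on \<open>B\<close> counts as a pattern, any two slices are comparable on the whole of
  \<open>B\<close> and no points are lost. Lines in earlier directions lie within a slice and are
  covered by induction; those in the last direction get their sign from the pattern.\<close>

lemma line_monotone_subgrid:
  assumes s: "s \<ge> 1"
  shows "is_array d A f \<Longrightarrow> (\<And>i. i \<in> {1..d} \<Longrightarrow> line_bound s d \<le> card (A i)) \<Longrightarrow>
    \<exists>B\<in>subgrids d A s. line_monotone d B f"
proof (induction d arbitrary: A f)
  case 0
  show ?case by (rule bexI[of _ "\<lambda>_. undefined"]) (auto simp: line_monotone_def subgrids_def)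
next
  case (Suc d)
  define r where "r = line_bound s d"
  define X where "X = A (Suc d)"
  have r: "r \<ge> 1" using line_bound_ge_1[OF s] by (simp add: r_def)
  have inj: "inj_on f (grid (Suc d) A)" and fin: "\<And>i. i \<in> {1..Suc d} \<Longrightarrow> finite (A i)"
    using Suc.prems(1) by (auto simp: is_array_def)
  have "r \<le> card (A i)" if "i \<in> {1..d}" for i
    using Suc.prems(2)[of i] line_bound_mono[OF s, of d] that unfolding r_def
    by (meson atLeastAtMost_iff le_SucI le_trans)
  then obtain A' where A': "\<And>i. i \<in> {1..d} \<Longrightarrow> A' i \<subseteq> A i \<and> finite (A' i) \<and> card (A' i) = r"
    using ex_trimmed_sides[of d A r] fin by (metis atLeastAtMost_iff le_SucI)
  have A'_grid: "b(Suc d := x) \<in> grid (Suc d) A" if "b \<in> grid d A'" "x \<in> X" for b x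
    using grid_mono[of d A' A] A' that unfolding X_def grid_Suc_iff by blast
  have fin_B: "finite (B i)" if "B \<in> subgrids d A' s" "i \<in> {1..d}" for B i
    using subgridsD(1)[OF that] A'[OF that(2)] finite_subset by blast
  define F where "F = subgrids d A' s"
  define good where "good x B \<longleftrightarrow> line_monotone d B (\<lambda>b. f (b(Suc d := x)))" for x B
  define P where "P B = Pi\<^sub>E (grid d B) (\<lambda>_. UNIV :: bool set)" for B
  define R where "R B p x y \<longleftrightarrow>
    (\<forall>b\<in>grid d B. less_dir (p b) (f (b(Suc d := x))) (f (b(Suc d := y))))" for B and p :: "_ \<Rightarrow> bool" and x y
  have "\<exists>B\<in>F. \<exists>p\<in>P B. \<exists>Y\<subseteq>X. card Y = s \<and> (\<forall>x\<in>Y. good x B) \<and>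
      (\<forall>x\<in>Y. \<forall>y\<in>Y. x < y \<longrightarrow> R B p x y)"
  proof (rule pigeonhole_chain)
    show "finite X" using fin by (simp add: X_def)
    show "finite F" unfolding F_def using A' by (intro finite_subgrids) blast
    have "r choose s \<le> r ^ s"
      by (cases "s \<le> r") (simp_all add: binomial_le_pow binomial_eq_0)
    then show "card F \<le> r ^ (s * d)"
      using card_subgrids[of d A' r s] A' power_mono[of "r choose s" "r ^ s" d]
      unfolding F_def power_mult by simp
    show "1 \<le> r ^ (s * d)" using r by simp
    show "\<exists>B\<in>F. good x B" if "x \<in> X" for x
      unfolding F_def good_def
    proof (rule Suc.IH)
      have "inj_on (\<lambda>b. f (b(Suc d := x))) (grid d A')"
      proof (rule inj_onI)
        fix b c assume bc: "b \<in> grid d A'" "c \<in> grid d A'" "f (b(Suc d := x)) = f (c(Suc d := x))"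
        have eq: "b(Suc d := x) = c(Suc d := x)"
          using bc(3) by (rule inj_onD[OF inj]) (use A'_grid bc that in blast)+
        \<comment> \<open>Points of the smaller grid are \<open>undefined\<close> at
          \<open>Suc d\<close>, so the common update there can be undone.\<close>
        have "b (Suc d) = c (Suc d)" using bc(1,2) by (simp add: grid_def PiE_iff extensional_def)
        then show "b = c" using eq by (metis fun_upd_triv fun_upd_upd)
      qed
      moreover have "A' i \<noteq> {}" if "i \<in> {1..d}" for i
        using A'[OF that] r by auto
      ultimately show "is_array d A' (\<lambda>b. f (b(Suc d := x)))"
        using A' by (simp add: is_array_def)
    qed (use A' r_def in auto)
    show "finite (P B) \<and> P B \<noteq> {} \<and> card (P B) \<le> 2 ^ (s ^ d)" if "B \<in> F" for B
    proof -
      have B: "finite (grid d B)" "card (grid d B) = s ^ d"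
        using fin_B subgridsD(2) that unfolding F_def by (auto intro!: finite_grid card_grid)
      then have "finite (P B)" "card (P B) = 2 ^ (s ^ d)"
        unfolding P_def by (auto intro!: finite_PiE simp: card_PiE)
      moreover have "P B \<noteq> {}" by (simp add: P_def PiE_eq_empty_iff)
      ultimately show ?thesis by simp
    qed
    show "\<exists>p\<in>P B. R B p x y" if "B \<in> F" "x \<in> X" "y \<in> X" "x < y" for B x y
    proof -
      have "\<exists>u. less_dir u (f (b(Suc d := x))) (f (b(Suc d := y)))" if b: "b \<in> grid d B" for b
      proof (rule ex_less_dir)
        have "b \<in> grid d A'"
          using b grid_mono[of d B A'] subgridsD(1) \<open>B \<in> F\<close> unfolding F_def by blast
        then have "b(Suc d := x) \<in> grid (Suc d) A" "b(Suc d := y) \<in> grid (Suc d) A"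
          using A'_grid \<open>x \<in> X\<close> \<open>y \<in> X\<close> by blast+
        moreover have "b(Suc d := x) \<noteq> b(Suc d := y)"
          using \<open>x < y\<close> by (metis fun_upd_same less_irrefl)
        ultimately show "f (b(Suc d := x)) \<noteq> f (b(Suc d := y))"
          using inj by (meson inj_onD)
      qed
      then obtain p where p: "\<And>b. b \<in> grid d B \<Longrightarrow> less_dir (p b) (f (b(Suc d := x))) (f (b(Suc d := y)))"
        by metis
      then show ?thesis
        by (intro bexI[of _ "restrict p (grid d B)"]) (simp_all add: R_def P_def)
    qed
    show "R B p x z" if "R B p x y" "R B p y z" for B p x y z
      using that less_dir_trans unfolding R_def by blast
    show "r ^ (s * d) * s ^ 2 ^ s ^ d \<le> card X"
      using Suc.prems(2)[of "Suc d"] by (simp add: r_def X_def)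
  qed (use s in simp_all)
  then obtain B p Y where BpY: "B \<in> F" "Y \<subseteq> X" "card Y = s"
    and good: "\<And>x. x \<in> Y \<Longrightarrow> good x B" and R: "\<And>x y. x \<in> Y \<Longrightarrow> y \<in> Y \<Longrightarrow> x < y \<Longrightarrow> R B p x y"
    by blast
  have "subgrids d A' s \<subseteq> subgrids d A s" using A' by (intro subgrids_mono) blast
  then have sub: "B(Suc d := Y) \<in> subgrids (Suc d) A s"
    using BpY by (intro subgrids_SucI) (auto simp: F_def X_def)
  have "line_monotone (Suc d) (B(Suc d := Y)) f"
    unfolding line_monotone_def
  proof (intro ballI)
    fix i a assume i: "i \<in> {1..Suc d}" and "a \<in> grid (Suc d) (B(Suc d := Y))"
    then obtain b z where b: "b \<in> grid d B" "z \<in> Y" and a: "a = b(Suc d := z)"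
      unfolding grid_Suc_iff by auto
    show "\<exists>u. \<forall>x\<in>(B(Suc d := Y)) i. \<forall>y\<in>(B(Suc d := Y)) i.
      x < y \<longrightarrow> less_dir u (f (a(i := x))) (f (a(i := y)))"
    proof (cases "i = Suc d")
      case True
      have "less_dir (p b) (f (a(i := x))) (f (a(i := y)))" if "x \<in> Y" "y \<in> Y" "x < y" for x y
        using R[OF that] b by (simp add: R_def a True)
      then show ?thesis using True by auto
    next
      case False
      then have i': "i \<in> {1..d}" using i by auto
      \<comment> \<open>Updates at different coordinates commute, which exhibits the line as one
        inside the slice at \<open>z\<close>.\<close>
      have "a(i := x) = b(i := x, Suc d := z)" for x
        unfolding a using False by (simp add: fun_upd_twist)
      moreover have "\<exists>u. \<forall>x\<in>B i. \<forall>y\<in>B i. x < y \<longrightarrow>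
          less_dir u (f (b(i := x, Suc d := z))) (f (b(i := y, Suc d := z)))"
        using good[OF b(2)] b(1) i' unfolding good_def line_monotone_def by blast
      ultimately show ?thesis using False by simp
    qed
  qed
  with sub show ?case by blast
qed

section \<open>Monochromatic subgrids\<close>

text \<open>A product Ramsey property for colourings with colours in \<open>K\<close>. Sides of size
  at least \<open>S\<close> are allowed, so that it applies without trimming first.\<close>

definition grid_ramsey :: "'c set \<Rightarrow> nat \<Rightarrow> nat \<Rightarrow> nat \<Rightarrow> bool" where
  "grid_ramsey K d n S \<longleftrightarrow> (\<forall>A c. (\<forall>i\<in>{1..d}. finite (A i) \<and> S \<le> card (A i)) \<longrightarrow>
     c ` grid d A \<subseteq> K \<longrightarrow> (\<exists>B\<in>subgrids d A n. \<exists>k. \<forall>a\<in>grid d B. c a = k))"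

lemma grid_ramsey_0: "grid_ramsey K 0 n S"
  unfolding grid_ramsey_def by (auto simp: subgrids_def grid_def)

text \<open>The Kovari-Sos-Turan step. Each slice has a monochromatic subgrid; the pairs of a
  subgrid and a colour number at most \<open>(S choose n) ^ d * card K\<close>, so \<open>n\<close>
  slices agree on one pair.\<close>

lemma grid_ramsey_Suc:
  assumes IH: "grid_ramsey K d n S" and K: "finite K" "K \<noteq> {}" and n: "n \<ge> 1" "n \<le> S" and le: "S \<le> S'"
    and S': "(S choose n) ^ d * card K * n \<le> S'"
  shows "grid_ramsey K (Suc d) n S'"
  unfolding grid_ramsey_def
proof (intro allI impI)
  fix A and c :: "(nat \<Rightarrow> int) \<Rightarrow> 'a"
  assume A: "\<forall>i\<in>{1..Suc d}. finite (A i) \<and> S' \<le> card (A i)" and c: "c ` grid (Suc d) A \<subseteq> K"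
  define X where "X = A (Suc d)"
  obtain A' where A': "\<And>i. i \<in> {1..d} \<Longrightarrow> A' i \<subseteq> A i \<and> finite (A' i) \<and> card (A' i) = S"
    using ex_trimmed_sides[of d A S] A le by (metis atLeastAtMost_iff le_SucI le_trans)
  define F where "F = subgrids d A' n \<times> K"
  define good where "good x Bk \<longleftrightarrow> (\<forall>b\<in>grid d (fst Bk). c (b(Suc d := x)) = snd Bk)" for x and Bk :: "_ \<times> 'a"
  have "\<exists>Bk\<in>F. \<exists>p\<in>{()}. \<exists>Y\<subseteq>X. card Y = n \<and> (\<forall>x\<in>Y. good x Bk) \<and>
      (\<forall>x\<in>Y. \<forall>y\<in>Y. x < y \<longrightarrow> True)"
  proof (rule pigeonhole_chain)
    show "finite X" using A by (simp add: X_def)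
    show "finite F" unfolding F_def using A' K by (intro finite_cartesian_product finite_subgrids) blast
    show "card F \<le> (S choose n) ^ d * card K"
      using card_subgrids[of d A' S n] A' by (simp add: F_def card_cartesian_product)
    show "1 \<le> (S choose n) ^ d * card K" using K n by (simp add: Suc_le_eq card_gt_0_iff)
    show "\<exists>Bk\<in>F. good x Bk" if "x \<in> X" for x
    proof -
      have in_K: "c (b(Suc d := x)) \<in> K" if "b \<in> grid d A'" for b
      proof -
        have "b(Suc d := x) \<in> grid (Suc d) A"
          using grid_mono[of d A' A] A' that \<open>x \<in> X\<close> unfolding X_def grid_Suc_iff by blast
        then show ?thesis using c by blast
      qed
      then obtain B k where B: "B \<in> subgrids d A' n" "\<forall>b\<in>grid d B. c (b(Suc d := x)) = k"
        using IH[unfolded grid_ramsey_def, rule_format, of A' "\<lambda>b. c (b(Suc d := x))"] A' by auto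
      have "B i \<noteq> {}" if "i \<in> {1..d}" for i
        using subgridsD(2)[OF B(1) that] n by auto
      then obtain b where b: "b \<in> grid d B"
        unfolding grid_def using PiE_eq_empty_iff by (metis ex_in_conv)
      moreover have "grid d B \<subseteq> grid d A'" by (rule grid_mono) (rule subgridsD(1)[OF B(1)])
      \<comment> \<open>\<open>grid_ramsey\<close> does not say that the colour lies in
        \<open>K\<close>; it does because \<open>n \<ge> 1\<close> gives the subgrid a
        point.\<close>
      ultimately have "k \<in> K" using in_K[of b] B(2) by auto
      then show ?thesis using B by (intro bexI[of _ "(B, k)"]) (auto simp: F_def good_def)
    qed
    show "(S choose n) ^ d * card K * n ^ 1 \<le> card X"
      using S' A by (simp add: X_def le_trans)
  qed (use n in auto)
  then obtain B k Y where BY: "B \<in> subgrids d A' n" "Y \<subseteq> X" "card Y = n" "\<forall>x\<in>Y. good x (B, k)"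
    by (auto simp: F_def)
  have "subgrids d A' n \<subseteq> subgrids d A n" using A' by (intro subgrids_mono) blast
  then have "B(Suc d := Y) \<in> subgrids (Suc d) A n"
    using BY by (intro subgrids_SucI) (auto simp: X_def)
  moreover have "\<forall>a\<in>grid (Suc d) (B(Suc d := Y)). c a = k"
    using BY(4) by (auto simp: good_def grid_Suc_iff)
  ultimately show "\<exists>B\<in>subgrids (Suc d) A n. \<exists>k. \<forall>a\<in>grid (Suc d) B. c a = k" by blast
qed

text \<open>The inductive step started from dimension 0, where there is a single point.\<close>

lemma grid_ramsey_1:
  assumes "finite K" "K \<noteq> {}" "n \<ge> 1"
  shows "grid_ramsey K 1 n (card K * n)"
  using grid_ramsey_Suc[OF grid_ramsey_0 assms(1,2,3), of n "card K * n"] assms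
  by (simp add: Suc_le_eq card_gt_0_iff)

text \<open>
  The first step from dimension 1 to 2 bounds a binomial coefficient \<open>m choose n\<close> by \<open>2 ^ m\<close>;
  the bound \<open>m ^ n\<close> used in the later steps would cost a factor \<open>log n\<close> in the exponent there.
\<close>

lemma grid_ramsey_exp:
  assumes K: "finite K" "K \<noteq> {}"
  shows "\<exists>C\<ge>1. \<forall>n\<ge>1. grid_ramsey K (Suc (Suc d)) n (2 ^ (C * n ^ Suc d))"
proof (induction d)
  case 0
  define k where "k = card K"
  have k: "k \<ge> 1" using K by (simp add: k_def Suc_le_eq card_gt_0_iff)
  \<comment> \<open>In the constant \<open>1 + 2 * k\<close>, one \<open>k\<close> comes from the
    binomial coefficient and \<open>1 + k\<close> from
    \<open>k * n \<le> 2 ^ ((1 + k) * n)\<close>.\<close>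
  have "grid_ramsey K (Suc (Suc 0)) n (2 ^ ((1 + 2 * k) * n ^ Suc 0))" if n: "n \<ge> 1" for n
  proof (rule grid_ramsey_Suc)
    show "grid_ramsey K (Suc 0) n (k * n)" using grid_ramsey_1[OF K n] by (simp add: k_def)
    have kn: "k + n \<le> (1 + k) * n" using n k by (simp add: algebra_simps)
    have "k * n \<le> 2 ^ k * 2 ^ n" by (intro mult_le_mono less_imp_le less_exp)
    also have "\<dots> \<le> 2 ^ ((1 + k) * n)"
      unfolding power_add[symmetric] using kn by (intro power_increasing) auto
    finally have 1: "k * n \<le> 2 ^ ((1 + k) * n)" .
    also have "\<dots> \<le> 2 ^ ((1 + 2 * k) * n ^ Suc 0)" by (intro power_increasing) auto
    finally show "k * n \<le> 2 ^ ((1 + 2 * k) * n ^ Suc 0)" .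
    have "k * n choose n \<le> 2 ^ (k * n)" by (rule binomial_le_pow2)
    then have "(k * n choose n) ^ Suc 0 * (k * n) \<le> 2 ^ (k * n) * 2 ^ ((1 + k) * n)"
      using 1 by (intro mult_le_mono) auto
    also have "\<dots> = 2 ^ ((1 + 2 * k) * n ^ Suc 0)"
      unfolding power_add[symmetric] by (simp add: algebra_simps)
    finally show "(k * n choose n) ^ Suc 0 * card K * n \<le> 2 ^ ((1 + 2 * k) * n ^ Suc 0)"
      by (simp add: k_def mult.assoc)
    show "n \<le> k * n" using k by simp
  qed (use K n in auto)
  then show ?case by (intro exI[of _ "1 + 2 * k"]) auto
next
  case (Suc d)
  then obtain C where C: "C \<ge> 1" "\<And>n. n \<ge> 1 \<Longrightarrow> grid_ramsey K (Suc (Suc d)) n (2 ^ (C * n ^ Suc d))"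
    by blast
  \<comment> \<open>\<open>C * Suc (Suc d)\<close> comes from the power of the binomial coefficient;
    \<open>k\<close> and 1 absorb the factors \<open>card K\<close> and \<open>n\<close>.\<close>
  define k D where "k = card K" and "D = 1 + k + C * Suc (Suc d)"
  have "grid_ramsey K (Suc (Suc (Suc d))) n (2 ^ (D * n ^ Suc (Suc d)))" if n: "n \<ge> 1" for n
  proof (rule grid_ramsey_Suc)
    define S where "S = (2::nat) ^ (C * n ^ Suc d)"
    show "grid_ramsey K (Suc (Suc d)) n S" using C(2)[OF n] by (simp add: S_def)
    have "n = n ^ 1" by simp
    also have "n ^ 1 \<le> n ^ Suc d" using n by (intro power_increasing) auto
    also have "\<dots> \<le> C * n ^ Suc d" using C(1) by simp
    also have "\<dots> < S" unfolding S_def by (rule less_exp)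
    finally show "n \<le> S" by simp
    have "C * n ^ Suc d \<le> D * n ^ Suc (Suc d)"
      using n by (intro mult_le_mono power_increasing) (auto simp: D_def)
    then show "S \<le> 2 ^ (D * n ^ Suc (Suc d))"
      unfolding S_def by (intro power_increasing) auto
    have "n ^ 1 \<le> n ^ Suc (Suc d)" using n by (intro power_increasing) auto
    then have "n \<le> n ^ Suc (Suc d)" by (simp only: power_one_right)
    moreover have "1 \<le> n ^ Suc (Suc d)" using n by (rule one_le_power)
    then have "k * 1 \<le> k * n ^ Suc (Suc d)" by (rule mult_le_mono2)
    ultimately have "n + k * 1 \<le> n ^ Suc (Suc d) + k * n ^ Suc (Suc d)" by (rule add_le_mono)
    then have kn: "k + n \<le> (1 + k) * n ^ Suc (Suc d)"
      by (simp only: distrib_right mult_1 mult_1_right add.commute)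
    have "S choose n \<le> S ^ n"
      using \<open>n \<le> S\<close> by (rule binomial_le_pow)
    then have "(S choose n) ^ Suc (Suc d) \<le> (S ^ n) ^ Suc (Suc d)" by (intro power_mono) auto
    also have "\<dots> = 2 ^ (C * Suc (Suc d) * n ^ Suc (Suc d))"
      unfolding S_def power_mult[symmetric] by (simp add: algebra_simps)
    finally have "(S choose n) ^ Suc (Suc d) * k * n \<le> 2 ^ (C * Suc (Suc d) * n ^ Suc (Suc d)) * 2 ^ k * 2 ^ n"
      by (intro mult_le_mono less_imp_le[OF less_exp]) auto
    also have "\<dots> \<le> 2 ^ (D * n ^ Suc (Suc d))"
      unfolding power_add[symmetric] D_def
      using kn by (intro power_increasing) (auto simp: algebra_simps)
    finally show "(S choose n) ^ Suc (Suc d) * card K * n \<le> 2 ^ (D * n ^ Suc (Suc d))"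
      by (simp add: k_def)
  qed (use K n in auto)
  then show ?case by (intro exI[of _ D]) (auto simp: D_def)
qed

section \<open>Arbitrary dimension: making parallel lines agree\<close>

lemma forces_monotone_line_bound:
  assumes R: "grid_ramsey (Pow {1..d}) d n s" and n: "n \<ge> 1" and s: "s \<ge> 1"
  shows "forces_monotone d n (line_bound s d)"
proof (rule forces_monotoneI[OF n])
  fix A f assume arr: "is_array d A f" and size: "has_cubic_size d A (line_bound s d)"
  obtain B where B: "B \<in> subgrids d A s" "line_monotone d B f"
    using line_monotone_subgrid[OF s arr] size by (auto simp: has_cubic_size_def)
  \<comment> \<open>The colour of a point records which of the lines through it are increasing. As
    all lines of \<open>B\<close> are monotone, it determines their directions, and a monochromatic
    subgrid is monotone.\<close>
  define c where "c a = {i\<in>{1..d}. \<forall>x\<in>B i. \<forall>y\<in>B i. x < y \<longrightarrow> f (a(i := x)) < f (a(i := y))}" for a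
  have fin: "\<forall>i\<in>{1..d}. finite (B i) \<and> s \<le> card (B i)"
    using subgridsD[OF B(1)] arr finite_subset unfolding is_array_def by (metis order_refl)
  have "c ` grid d B \<subseteq> Pow {1..d}" by (auto simp: c_def)
  from R[unfolded grid_ramsey_def, THEN spec, THEN spec, THEN mp, THEN mp, OF fin this]
  obtain B' D where B': "B' \<in> subgrids d B n" "\<And>a. a \<in> grid d B' \<Longrightarrow> c a = D"
    by blast
  show "\<exists>B. (\<forall>i\<in>{1..d}. B i \<subseteq> A i \<and> card (B i) = n) \<and>
        (\<forall>i\<in>{1..d}. \<exists>u. \<forall>a\<in>grid d B. \<forall>x\<in>B i. \<forall>y\<in>B i. x < y \<longrightarrow>
          less_dir u (f (a(i := x))) (f (a(i := y))))"
  proof (rule exI[of _ B'], intro conjI ballI)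
    fix i assume i: "i \<in> {1..d}"
    show "card (B' i) = n" using subgridsD(2)[OF B'(1) i] .
    have B'B: "B' i \<subseteq> B i" using subgridsD(1)[OF B'(1) i] .
    then show "B' i \<subseteq> A i" using subgridsD(1)[OF B(1) i] by blast
    have "less_dir (i \<in> D) (f (a(i := x))) (f (a(i := y)))"
      if a: "a \<in> grid d B'" and xy: "x \<in> B' i" "y \<in> B' i" "x < y" for a x y
    proof -
      have ca: "i \<in> D \<longleftrightarrow> (\<forall>x\<in>B i. \<forall>y\<in>B i. x < y \<longrightarrow> f (a(i := x)) < f (a(i := y)))"
        using B'(2)[OF a] i unfolding c_def by blast
      have "a \<in> grid d B" using a grid_mono[of d B' B] subgridsD(1)[OF B'(1)] by blast
      then obtain u where u: "\<And>x y. x \<in> B i \<Longrightarrow> y \<in> B i \<Longrightarrow> x < y \<Longrightarrow>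
          less_dir u (f (a(i := x))) (f (a(i := y)))"
        using B(2) i unfolding line_monotone_def by meson
      \<comment> \<open>The converse needs the fixed pair \<open>x < y\<close>: on a side with one
        element \<open>i \<in> D\<close> holds vacuously.\<close>
      have "u = (i \<in> D)"
      proof
        assume u show "i \<in> D" unfolding ca using u \<open>u\<close> by (simp add: less_dir_def)
      next
        assume "i \<in> D"
        then have "f (a(i := x)) < f (a(i := y))" using ca xy B'B by blast
        then show u using u[OF subsetD[OF B'B xy(1)] subsetD[OF B'B xy(2)] xy(3)]
          by (auto simp: less_dir_def split: if_splits)
      qed
      then show ?thesis using u xy B'B by blast
    qed
    then show "\<exists>u. \<forall>a\<in>grid d B'. \<forall>x\<in>B' i. \<forall>y\<in>B' i. x < y \<longrightarrow>
          less_dir u (f (a(i := x))) (f (a(i := y)))" by blast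
  qed
qed

text \<open>Crude estimates such as \<open>s \<le> 2 ^ s\<close> suffice: \<open>s\<close> will be
  exponential in \<open>n ^ (d - 1)\<close>, so the power \<open>s ^ d\<close> only changes the
  constant there.\<close>

lemma line_bound_le:
  "\<exists>c. \<forall>s\<ge>1. line_bound s d \<le> 2 ^ (2 ^ (c * s ^ d))"
proof (induction d)
  case (Suc d)
  then obtain c where c: "\<And>s. s \<ge> 1 \<Longrightarrow> line_bound s d \<le> 2 ^ (2 ^ (c * s ^ d))" by blast
  \<comment> \<open>The 3 pays for the terms \<open>s\<close> and \<open>s ^ d\<close>, each at most
    \<open>t\<close>, and for the doubling when two summands are merged.\<close>
  have "line_bound s (Suc d) \<le> 2 ^ (2 ^ ((c + d + 3) * s ^ Suc d))" if s: "s \<ge> 1" for s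
  proof -
    define t where "t = s ^ Suc d"
    have "1 \<le> t" using s unfolding t_def by (rule one_le_power)
    have "s ^ 1 \<le> t" "s ^ d \<le> t" using s unfolding t_def by (intro power_increasing; simp)+
    with \<open>1 \<le> t\<close> have t: "s \<le> t" "s ^ d \<le> t" "d \<le> d * t" "c * s ^ d \<le> c * t" by auto
    have "line_bound s (Suc d) \<le> (2 ^ (2 ^ (c * s ^ d))) ^ (s * d) * (2 ^ s) ^ (2 ^ (s ^ d))"
      unfolding line_bound.simps by (intro mult_le_mono power_mono c s less_imp_le[OF less_exp]) auto
    also have "\<dots> = 2 ^ (2 ^ (c * s ^ d) * (s * d) + s * 2 ^ (s ^ d))"
      by (simp only: power_mult power_add)
    also have "\<dots> \<le> 2 ^ (2 ^ ((c + d + 3) * t))"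
    proof (rule power_increasing)
      have "2 ^ (c * s ^ d) * (s * d) \<le> 2 ^ (c * s ^ d) * (2 ^ s * 2 ^ d)"
        by (intro mult_le_mono less_imp_le[OF less_exp]) auto
      also have "\<dots> \<le> 2 ^ (c * t + t + d * t)"
        unfolding power_add[symmetric] using t by (intro power_increasing; linarith)
      finally have 1: "2 ^ (c * s ^ d) * (s * d) \<le> 2 ^ (c * t + t + d * t)" .
      have "s * 2 ^ (s ^ d) \<le> 2 ^ s * 2 ^ (s ^ d)" by (intro mult_le_mono less_imp_le[OF less_exp]) auto
      also have "\<dots> \<le> 2 ^ (c * t + d * t + 2 * t)"
        unfolding power_add[symmetric] using t by (intro power_increasing; linarith)
      finally have 2: "s * 2 ^ (s ^ d) \<le> 2 ^ (c * t + d * t + 2 * t)" .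
      have "(2::nat) ^ (c * t + t + d * t) \<le> 2 ^ (c * t + d * t + 2 * t)"
        by (intro power_increasing) auto
      with 1 2 have "2 ^ (c * s ^ d) * (s * d) + s * 2 ^ (s ^ d) \<le> 2 * 2 ^ (c * t + d * t + 2 * t)"
        by linarith
      also have "\<dots> = 2 ^ (c * t + d * t + 2 * t + 1)" by simp
      also have "\<dots> \<le> 2 ^ ((c + d + 3) * t)"
        using \<open>1 \<le> t\<close> by (intro power_increasing) (auto simp: algebra_simps)
      finally show "2 ^ (c * s ^ d) * (s * d) + s * 2 ^ (s ^ d) \<le> 2 ^ ((c + d + 3) * t)" .
    qed simp
    finally show ?thesis by (simp add: t_def)
  qed
  then show ?case by blast
qed (auto intro!: exI[of _ 0])

section \<open>Asymptotic bounds\<close>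

lemma M_le: "forces_monotone d n N \<Longrightarrow> N > 0 \<Longrightarrow> M d n \<le> N"
  unfolding M_def by (rule Least_le) simp

text \<open>The error term is simply defined as \<open>log 2 L / m - 2\<close>, which makes the
  inequality an identity after \<open>M d n \<le> N\<close>; what remains for each dimension is a
  limit.\<close>

lemma M_upper_bound_from_log:
  assumes "forces_monotone d n N" and L: "log 2 (real N) = L" "L > 0" and m: "m > 0"
  shows "real (M d n) \<le> 2 powr (2 powr ((2 + (log 2 L / m - 2)) * m))"
proof -
  \<comment> \<open>\<open>log 2 0\<close> is 0 by convention, so \<open>L > 0\<close> excludes
    \<open>N = 0\<close>.\<close>
  have N: "N > 0" using L by (cases N) (auto simp: log_def)
  have "real (M d n) \<le> real N" using M_le[OF assms(1) N] by simp
  also have "\<dots> = 2 powr L" using N L(1) by (metis of_nat_0_less_iff powr_log_cancel zero_less_numeral numeral_eq_one_iff semiring_norm(85))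
  also have "L = 2 powr (log 2 L)" using L(2) by simp
  also have "log 2 L = (2 + (log 2 L / m - 2)) * m" using m by simp
  finally show ?thesis .
qed

lemma log_planar_bound:
  assumes "b \<ge> 1"
  shows "log 2 (planar_bound a b) = 1 + 4 * real a ^ 2 + 2 * 2 ^ (2 * a) * log 2 b"
  using assms by (simp add: planar_bound_def log_mult log_nat_power)

text \<open>The logarithm is spelled out in \<open>n\<close> to make its growth computable. The
  middle line is \<open>b * log 2 r\<close>, and the last comes from the power of
  \<open>n\<close>.\<close>

definition log_spatial_bound :: "nat \<Rightarrow> real" where
  "log_spatial_bound n = (2 + 16 * real n ^ 2 +
     2 * 2 ^ (2 * n) * real n * (1 + 16 * real n ^ 2 + 2 * 2 ^ (4 * n) * (1 + 2 * real n + log 2 n)) +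
     2 * 2 ^ (2 * n) * (2 * 2 ^ (2 * n) * real n) ^ n * log 2 n)"

lemma log_spatial_bound:
  assumes n: "n \<ge> 1"
  shows "log 2 (spatial_bound n) = log_spatial_bound n"
proof -
  define b where "b = rectangle_bound n"
  define r where "r = planar_bound (2 * n) b"
  have b: "b \<ge> 1" using n by (simp add: b_def rectangle_bound_def)
  have r: "r \<ge> 1" using b by (simp add: r_def planar_bound_def)
  have "log 2 4 = 2" using log_nat_power[of 2 2 2] by simp
  moreover have "log 2 b = 1 + 2 * n + log 2 n"
    using n by (simp add: b_def rectangle_bound_def log_mult log_nat_power)
  moreover have "log 2 r = 1 + 16 * real n ^ 2 + 2 * 2 ^ (4 * n) * log 2 b"
    using log_planar_bound[OF b, of "2 * n"] by (simp add: r_def power_mult_distrib)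
  moreover have "spatial_bound n = 4 * 2 ^ (2 * (2 * n))\<^sup>2 * r ^ b * n ^ (2 * 2 ^ (2 * n) * b ^ n)"
    by (simp add: spatial_bound_def Let_def r_def b_def)
  then have "log 2 (spatial_bound n) =
      log 2 4 + 16 * real n ^ 2 + b * log 2 r + 2 * 2 ^ (2 * n) * real b ^ n * log 2 n"
    using n r by (simp add: log_mult log_nat_power)
  ultimately show ?thesis
    unfolding log_spatial_bound_def by (simp add: b_def rectangle_bound_def)
qed

lemma M_2_bound:
  "\<exists>\<epsilon> :: nat \<Rightarrow> real. \<epsilon> \<longlonglongrightarrow> 0 \<and>
    (\<forall>n\<ge>1. real (M 2 n) \<le> 2 powr (2 powr ((2 + \<epsilon> n) * real n)))"
proof (intro exI conjI allI impI)
  \<comment> \<open>The last summand dominates; for large \<open>n\<close> its logarithm is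
    \<open>2 * n + 1 + log 2 (log 2 n)\<close>.\<close>
  show "(\<lambda>n. log 2 (1 + 4 * real n ^ 2 + 2 * 2 ^ (2 * n) * log 2 n) / real n - 2) \<longlonglongrightarrow> 0"
    by real_asymp
  fix n :: nat assume n: "n \<ge> 1"
  then have "log 2 n \<ge> 0" by simp
  \<comment> \<open>At \<open>n = 1\<close> the logarithmic summand vanishes, and the others keep
    the sum positive.\<close>
  then have "1 + 4 * real n ^ 2 + 2 * 2 ^ (2 * n) * log 2 n > 0" by (intro add_pos_nonneg) auto
  then show "real (M 2 n) \<le> 2 powr (2 powr
      ((2 + (log 2 (1 + 4 * real n ^ 2 + 2 * 2 ^ (2 * n) * log 2 n) / real n - 2)) * real n))"
    using M_upper_bound_from_log[OF forces_monotone_2[OF n] log_planar_bound[OF n]] n by simp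
qed

lemma M_3_bound:
  "\<exists>\<epsilon> :: nat \<Rightarrow> real. \<epsilon> \<longlonglongrightarrow> 0 \<and>
    (\<forall>n\<ge>1. real (M 3 n) \<le> 2 powr (2 powr ((2 + \<epsilon> n) * real n ^ 2)))"
proof (intro exI conjI allI impI)
  \<comment> \<open>The summand with the \<open>n\<close>-th power of
    \<open>2 * 2 ^ (2 * n) * n\<close> dominates; its logarithm is \<open>2 * n ^ 2\<close> up to
    order \<open>n * log n\<close>.\<close>
  show "(\<lambda>n. log 2 (log_spatial_bound n) / real n ^ 2 - 2) \<longlonglongrightarrow> 0"
    unfolding log_spatial_bound_def by real_asymp
  fix n :: nat assume n: "n \<ge> 1"
  then have "log 2 n \<ge> 0" by simp
  then have "log_spatial_bound n > 0"
    unfolding log_spatial_bound_def by (intro add_pos_nonneg mult_nonneg_nonneg add_nonneg_nonneg) auto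
  then show "real (M 3 n) \<le> 2 powr (2 powr
      ((2 + (log 2 (log_spatial_bound n) / real n ^ 2 - 2)) * real n ^ 2))"
    using n by (intro M_upper_bound_from_log[OF forces_monotone_3[OF n] log_spatial_bound[OF n]]) auto
qed

lemma M_bound:
  assumes d: "d \<ge> 2"
  shows "\<exists>C :: real. \<forall>n\<ge>1. real (M d n) \<le> 2 powr (2 powr (2 powr (C * real n ^ (d - 1))))"
proof -
  obtain e where e: "d = Suc (Suc e)" using d by (metis Suc_le_D numeral_2_eq_2 Suc_le_mono)
  obtain C where C: "\<And>n. n \<ge> 1 \<Longrightarrow> grid_ramsey (Pow {1..d}) d n (2 ^ (C * n ^ (d - 1)))"
    using grid_ramsey_exp[of "Pow {1..d}" e] unfolding e by auto
  obtain c where c: "\<And>s. s \<ge> 1 \<Longrightarrow> line_bound s d \<le> 2 ^ (2 ^ (c * s ^ d))"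
    using line_bound_le by blast
  have "real (M d n) \<le> 2 powr (2 powr (2 powr (real (c + C * d) * real n ^ (d - 1))))" if n: "n \<ge> 1" for n
  proof -
    \<comment> \<open>For this \<open>s\<close>, \<open>s ^ d\<close> is
      \<open>2 ^ (C * d * n ^ (d - 1))\<close>, which supplies the third exponential and the
      constant \<open>c + C * d\<close>.\<close>
    define s where "s = (2::nat) ^ (C * n ^ (d - 1))"
    have s: "s \<ge> 1" by (simp add: s_def)
    have "M d n \<le> line_bound s d"
      using forces_monotone_line_bound[OF _ n s] C[OF n] line_bound_ge_1[OF s, of d]
      by (intro M_le) (auto simp: s_def)
    also have "\<dots> \<le> 2 ^ (2 ^ (c * s ^ d))" by (rule c[OF s])
    also have "\<dots> \<le> 2 ^ (2 ^ (2 ^ ((c + C * d) * n ^ (d - 1))))"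
    proof (intro power_increasing)
      have "c * s ^ d \<le> 2 ^ c * 2 ^ (C * n ^ (d - 1) * d)"
        unfolding s_def power_mult by (intro mult_le_mono less_imp_le[OF less_exp]) simp
      also have "\<dots> \<le> 2 ^ ((c + C * d) * n ^ (d - 1))"
        unfolding power_add[symmetric] using n by (intro power_increasing) (auto simp: algebra_simps)
      finally show "c * s ^ d \<le> 2 ^ ((c + C * d) * n ^ (d - 1))" .
    qed auto
    finally have "real (M d n) \<le> real (2 ^ (2 ^ (2 ^ ((c + C * d) * n ^ (d - 1)))))"
      by (rule of_nat_mono)
    also have "\<dots> = 2 powr real (2 ^ (2 ^ ((c + C * d) * n ^ (d - 1))))"
      by (subst powr_realpow) simp_all
    also have "real (2 ^ (2 ^ ((c + C * d) * n ^ (d - 1)))) = 2 powr real (2 ^ ((c + C * d) * n ^ (d - 1)))"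
      by (subst powr_realpow) simp_all
    also have "real (2 ^ ((c + C * d) * n ^ (d - 1))) = 2 powr real ((c + C * d) * n ^ (d - 1))"
      by (subst powr_realpow) simp_all
    finally show ?thesis by simp
  qed
  then show ?thesis by blast
qed

text \<open>Ensures that the minimum in the definition of \<open>M\<close> is attained. Dimension 1
  is separate, since \<open>grid_ramsey_exp\<close> starts at dimension 2.\<close>

lemma ex_forces_monotone:
  assumes d: "d \<ge> 1" and n: "n \<ge> 1"
  shows "\<exists>N>0. forces_monotone d n N"
proof -
  have "\<exists>s\<ge>1. grid_ramsey (Pow {1..d}) d n s"
  proof (cases "d = 1")
    case True
    have "grid_ramsey (Pow {1..1::nat}) 1 n (card (Pow {1..1::nat}) * n)"
      using n by (intro grid_ramsey_1) auto
    then show ?thesis unfolding True using n by (intro exI conjI) (auto simp: card_Pow)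
  next
    case False
    then obtain e where e: "d = Suc (Suc e)" using d by (metis One_nat_def not0_implies_Suc not_one_le_zero)
    then obtain C where "grid_ramsey (Pow {1..d}) d n (2 ^ (C * n ^ Suc e))"
      using grid_ramsey_exp[of "Pow {1..d}" e] n by auto
    then show ?thesis by (intro exI conjI) auto
  qed
  then obtain s where s: "s \<ge> 1" "grid_ramsey (Pow {1..d}) d n s" by blast
  then show ?thesis
    using forces_monotone_line_bound[OF s(2) n s(1)] line_bound_ge_1[OF s(1), of d]
    by (intro exI[of _ "line_bound s d"]) auto
qed

theorem theorem1p1:
  shows "(\<forall>d\<ge>1. \<forall>n\<ge>1. \<exists>N>0. forces_monotone d n N) \<and>
    (\<exists>\<epsilon> :: nat \<Rightarrow> real. \<epsilon> \<longlonglongrightarrow> 0 \<and>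
       (\<forall>n\<ge>1. real (M 2 n) \<le> 2 powr (2 powr ((2 + \<epsilon> n) * real n)))) \<and>
    (\<exists>\<epsilon> :: nat \<Rightarrow> real. \<epsilon> \<longlonglongrightarrow> 0 \<and>
       (\<forall>n\<ge>1. real (M 3 n) \<le> 2 powr (2 powr ((2 + \<epsilon> n) * real n ^ 2)))) \<and>
    (\<forall>d\<ge>4. \<exists>C :: real. \<forall>n\<ge>1.
       real (M d n) \<le> 2 powr (2 powr (2 powr (C * real n ^ (d - 1)))))"
  using ex_forces_monotone M_2_bound M_3_bound M_bound by simp

end
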